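(* For every $\beta\in(\gamma_0,\infty)$, $$\tilde t(\beta)=\frac{P(-\hat q(\beta))}\beta-\hat q(\beta)=\frac1\beta\inf_{q<-1/2}\{P(-q)-q\beta\},$$ where $\hat q(\beta)<-1/2$ is the solution $q$ of $\frac{d}{dq}\big[P(-q)\big]=\beta$.
   Context: $\gamma_0=2\log\frac{1+\sqrt5}2$. Write $[\omega_1,\dots,\omega_n+x]=\cfrac{1}{\omega_1+\cfrac{1}{\ddots+\cfrac{1}{\omega_n+x}}}$. For $s>1/2$, $$P(s)=\lim_{n\to\infty}\frac1n\log\sum_{\omega_1=1}^\infty\cdots\sum_{\omega_n=1}^\infty\exp\Big(\sup_{x\in[0,1]}\log\prod_{j=1}^n([\omega_j,\dots,\omega_n+x])^{2s}\Big),$$ a real-analytic function on $(1/2,\infty)$, and $P_1(\tilde t,q)=P(\tilde t-q)$ for $\tilde t-q>1/2$. For $\beta\in(\gamma_0,\infty)$, $\tilde t(\beta)$ is the first coordinate of the unique solution $(\tilde t,q)$ in $\tilde D_0=\{(\tilde t,q)\in\mathbb{R}^2:\tilde t-q>1/2,\ 0\le\tilde t\le1\}$ of the system $P_1(\tilde t,q)=q\beta$, $\frac{\partial P_1}{\partial q}(\tilde t,q)=\beta$. *)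

theory Defs
  imports "HOL-Analysis.Analysis"
begin

definition gamma0 :: real where
  "gamma0 = 2 * ln ((1 + sqrt 5) / 2)"

text \<open>\<open>cf [\<omega>\<^sub>1, \<dots>, \<omega>\<^sub>n] x\<close> is \<open>[\<omega>\<^sub>1, \<dots>, \<omega>\<^sub>n + x]\<close>, i.e. \<open>1 / (\<omega>\<^sub>1 + 1 / (\<dots> + 1 / (\<omega>\<^sub>n + x)))\<close>.
  The value at the empty word is only the base of the recursion.\<close>

primrec cf :: "nat list \<Rightarrow> real \<Rightarrow> real" where
  "cf [] x = x"
| "cf (w # ws) x = 1 / (real w + cf ws x)"

definition words :: "nat \<Rightarrow> nat list set" where
  "words n = {ws. length ws = n \<and> (\<forall>w\<in>set ws. 1 \<le> w)}"

text \<open>All terms are nonnegative, so the iterated sum over \<open>\<omega>\<^sub>1, \<dots>, \<omega>\<^sub>n\<close> is the unordered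
  sum over all words of length \<open>n\<close>; it is finite for \<open>s > 1/2\<close>, the only range in which
  \<open>pressure\<close> is meaningful. The factor with index \<open>j\<close> is \<open>[\<omega>\<^bsub>j+1\<^esub>, \<dots>, \<omega>\<^sub>n + x]\<close>.\<close>

definition partition_sum :: "nat \<Rightarrow> real \<Rightarrow> real" where
  "partition_sum n s =
     (\<Sum>\<^sub>\<infinity>ws\<in>words n. exp (SUP x\<in>{0..1}. ln (\<Prod>j<n. cf (drop j ws) x powr (2 * s))))"

definition pressure :: "real \<Rightarrow> real" where
  "pressure s = lim (\<lambda>n. 1 / real n * ln (partition_sum n s))"

definition P1 :: "real \<Rightarrow> real \<Rightarrow> real" where
  "P1 t q = pressure (t - q)"

definition D0 :: "(real \<times> real) set" where
  "D0 = {(t, q). t - q > 1/2 \<and> 0 \<le> t \<and> t \<le> 1}"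

definition solves_system :: "real \<Rightarrow> real \<times> real \<Rightarrow> bool" where
  "solves_system \<beta> = (\<lambda>(t, q).
     P1 t q = q * \<beta> \<and> ((\<lambda>q'. P1 t q') has_real_derivative \<beta>) (at q))"

definition tilde_t :: "real \<Rightarrow> real" where
  "tilde_t \<beta> = fst (THE p. p \<in> D0 \<and> solves_system \<beta> p)"

definition is_hat_q :: "real \<Rightarrow> real \<Rightarrow> bool" where
  "is_hat_q \<beta> q \<longleftrightarrow> q < -1/2 \<and> ((\<lambda>q'. pressure (- q')) has_real_derivative \<beta>) (at q)"

definition hat_q :: "real \<Rightarrow> real" where
  "hat_q \<beta> = (THE q. is_hat_q \<beta> q)"

end

theory Submission imports Defs
begin

text \<open>With \<open>s = t - q\<close> the system reads \<open>P'(s) = -\<beta>\<close>, \<open>q = P(s) / \<beta>\<close>, so everything follows once \<open>P\<close> is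
  differentiable and strictly convex on \<open>(1/2, \<infinity>)\<close> and \<open>s \<mapsto> P(s) + s \<beta>\<close> tends to infinity at both
  ends; then \<open>t = min (P(s) + s \<beta>) / \<beta>\<close>, which lies in \<open>[0, 1]\<close> because \<open>P(s) \<ge> -s \<gamma>\<^sub>0\<close> and \<open>P(1) \<le> 0\<close>.

  \<open>P(s)\<close> is the logarithm of the leading eigenvalue of the transfer operator of the Gauss map, whose
  eigenfunction is found by Birkhoff's contraction argument in a cone of log-Lipschitz functions. The
  eigenvalue is estimated from test functions: if \<open>L g \<le> \<mu> g\<close> for some \<open>g\<close> bounded away from 0 and
  infinity, it is at most \<open>\<mu>\<close>, and similarly from below. The test functions \<open>h exp (d u)\<close>, with \<open>u\<close> an
  approximate solution of the linearised eigenvalue equation, give the derivative, and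
  \<open>sqrt (h\<^sub>0 h\<^sub>1)\<close> gives strict convexity.\<close>

section \<open>The transfer operator\<close>

definition branch :: "nat \<Rightarrow> real \<Rightarrow> real" where
  "branch n x = 1 / (real (Suc n) + x)"

definition transfer :: "real \<Rightarrow> (real \<Rightarrow> real) \<Rightarrow> real \<Rightarrow> real" where
  "transfer s f x = (\<Sum>n. branch n x powr (2 * s) * f (branch n x))"

definition logdist :: "real \<Rightarrow> real \<Rightarrow> real" where
  "logdist x y = \<bar>ln (1 + x) - ln (1 + y)\<bar>"

lemma branch_pos: "x \<in> {0..1} \<Longrightarrow> 0 < branch n x"
  by (auto simp: branch_def)

lemma branch_mem: "x \<in> {0..1} \<Longrightarrow> branch n x \<in> {0..1}"
  by (auto simp: branch_def field_simps)

lemma branch_le: "x \<in> {0..1} \<Longrightarrow> branch n x \<le> 1 / real (Suc n)"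
  by (auto simp: branch_def field_simps)

lemma branch_ge: "x \<in> {0..1} \<Longrightarrow> 1 / (real n + 2) \<le> branch n x"
  by (auto simp: branch_def field_simps)

lemma ln_branch_nonpos: "x \<in> {0..1} \<Longrightarrow> ln (branch n x) \<le> 0"
  using branch_pos branch_mem by (metis atLeastAtMost_iff ln_le_zero_iff)

lemma branch_powr_le:
  "x \<in> {0..1} \<Longrightarrow> 0 \<le> s \<Longrightarrow> branch n x powr (2 * s) \<le> real (Suc n) powr - (2 * s)"
  using powr_mono2[of "2 * s" "branch n x" "1 / real (Suc n)"] branch_le[of x n] branch_pos[of x n]
  by (simp add: powr_minus_divide powr_divide)

lemma summable_powr_Suc: "s > 1 / 2 \<Longrightarrow> summable (\<lambda>n. real (Suc n) powr - (2 * s))"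
  using summable_real_powr_iff[of "- (2 * s)"] summable_Suc_iff[of "\<lambda>n. real n powr - (2 * s)"]
  by simp

lemma summable_branch_bound:
  assumes "s > 1 / 2" "x \<in> {0..1}" "\<And>n. \<bar>a n\<bar> \<le> C * branch n x powr (2 * s)"
  shows "summable a"
proof (rule summable_comparison_test')
  show "summable (\<lambda>n. \<bar>C\<bar> * real (Suc n) powr - (2 * s))"
    by (intro summable_mult summable_powr_Suc assms)
  show "norm (a n) \<le> \<bar>C\<bar> * real (Suc n) powr - (2 * s)" for n
  proof -
    have "\<bar>a n\<bar> \<le> \<bar>C\<bar> * branch n x powr (2 * s)"
      using assms(3)[of n] mult_right_mono[OF abs_ge_self[of C], of "branch n x powr (2 * s)"] by simp
    also have "\<dots> \<le> \<bar>C\<bar> * real (Suc n) powr - (2 * s)"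
      using assms(1,2) by (intro mult_left_mono branch_powr_le) auto
    finally show ?thesis by simp
  qed
qed

lemma summable_transfer:
  assumes "s > 1 / 2" "bounded (f ` {0..1})" "x \<in> {0..1}"
  shows "summable (\<lambda>n. branch n x powr (2 * s) * f (branch n x))"
proof -
  obtain C where C: "\<And>y. y \<in> {0..1} \<Longrightarrow> \<bar>f y\<bar> \<le> C"
    using assms(2) unfolding bounded_iff by (metis imageI real_norm_def)
  have "\<bar>branch n x powr (2 * s) * f (branch n x)\<bar> \<le> C * branch n x powr (2 * s)" for n
    using C[OF branch_mem[OF assms(3)], of n] by (simp add: abs_mult mult.commute mult_right_mono)
  then show ?thesis
    by (rule summable_branch_bound[OF assms(1,3)])
qed

lemma transfer_cong:
  "x \<in> {0..1} \<Longrightarrow> (\<And>y. y \<in> {0..1} \<Longrightarrow> f y = g y) \<Longrightarrow> transfer s f x = transfer s g x"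
  by (simp add: transfer_def branch_mem del: atLeastAtMost_iff)

lemma transfer_scale:
  assumes "s > 1 / 2" "bounded (f ` {0..1})" "x \<in> {0..1}"
  shows "transfer s (\<lambda>y. c * f y) x = c * transfer s f x"
proof -
  have "transfer s (\<lambda>y. c * f y) x = (\<Sum>n. c * (branch n x powr (2 * s) * f (branch n x)))"
    unfolding transfer_def by (simp add: mult_ac)
  also have "\<dots> = c * transfer s f x"
    unfolding transfer_def using summable_transfer[OF assms] by (rule suminf_mult)
  finally show ?thesis .
qed

lemma bounded_scale: "bounded (f ` {0..1}) \<Longrightarrow> bounded ((\<lambda>y. c * f y :: real) ` {0..1::real})"
  using bounded_scaling[of "f ` {0..1}" c] by (simp add: image_image)

lemma transfer_diff:
  assumes "s > 1 / 2" "bounded (f ` {0..1})" "bounded (g ` {0..1})" "x \<in> {0..1}"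
  shows "transfer s (\<lambda>y. f y - g y) x = transfer s f x - transfer s g x"
  unfolding transfer_def
  using suminf_diff[OF summable_transfer[OF assms(1,2,4)] summable_transfer[OF assms(1,3,4)]]
  by (simp add: algebra_simps)

lemma transfer_mono:
  assumes "s > 1 / 2" "bounded (f ` {0..1})" "bounded (g ` {0..1})" "x \<in> {0..1}"
    and "\<And>y. y \<in> {0..1} \<Longrightarrow> f y \<le> g y"
  shows "transfer s f x \<le> transfer s g x"
  unfolding transfer_def
  using assms(5) by (intro suminf_le summable_transfer mult_left_mono assms(1-4)) (simp_all add: branch_mem[OF assms(4)] del: atLeastAtMost_iff)

lemma transfer_sum:
  assumes "s > 1 / 2" "\<And>k. k < N \<Longrightarrow> bounded (f k ` {0..1})" "x \<in> {0..1}"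
  shows "transfer s (\<lambda>y. \<Sum>k<N. f k y) x = (\<Sum>k<N. transfer s (f k) x)"
  unfolding transfer_def
  using assms by (subst suminf_sum[symmetric]) (auto intro!: summable_transfer simp: sum_distrib_left)

lemma transfer_one_le:
  assumes "s > 1 / 2" "x \<in> {0..1}"
  shows "transfer s (\<lambda>_. 1) x \<le> transfer s (\<lambda>_. 1) 0"
proof -
  have "bounded ((\<lambda>_. 1 :: real) ` {0..1::real})"
    by (auto simp: bounded_iff)
  moreover have "branch n x \<le> branch n 0" for n
    using assms(2) by (auto simp: branch_def field_simps)
  ultimately show ?thesis
    unfolding transfer_def
    using assms branch_pos[OF assms(2)] summable_transfer[of s "\<lambda>_. 1"]
    by (intro suminf_le) (simp_all add: powr_mono2 less_imp_le)
qed

lemma transfer_bound: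
  assumes "s > 1 / 2" "x \<in> {0..1}" and f: "\<And>y. y \<in> {0..1} \<Longrightarrow> \<bar>f y\<bar> \<le> C"
  shows "\<bar>transfer s f x\<bar> \<le> C * transfer s (\<lambda>_. 1) 0"
proof -
  have b1: "bounded ((\<lambda>_. c :: real) ` {0..1::real})" for c
    by (auto simp: bounded_iff)
  have bf: "bounded (f ` {0..1})"
    using f unfolding bounded_iff by (intro exI[of _ C]) (auto simp del: atLeastAtMost_iff)
  have C0: "C \<ge> 0" using f[of 0] by simp
  have cst: "transfer s (\<lambda>_. c) x = c * transfer s (\<lambda>_. 1) x" for c
    using transfer_scale[OF assms(1) b1 assms(2), of c 1] by simp
  have "transfer s f x \<le> transfer s (\<lambda>_. C) x" "transfer s (\<lambda>_. - C) x \<le> transfer s f x"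
    using abs_le_D1[OF f] abs_le_D2[OF f] by (intro transfer_mono assms(1,2) bf b1; force)+
  then have "\<bar>transfer s f x\<bar> \<le> C * transfer s (\<lambda>_. 1) x"
    using cst[of C] cst[of "- C"] by auto
  also have "\<dots> \<le> C * transfer s (\<lambda>_. 1) 0"
    by (intro mult_left_mono transfer_one_le assms C0)
  finally show ?thesis .
qed

section \<open>Cones of log-Lipschitz functions\<close>

lemma logdist_commute: "logdist x y = logdist y x"
  by (simp add: logdist_def)

lemma logdist_nonneg: "0 \<le> logdist x y"
  by (simp add: logdist_def)

lemma logdist_le: "x \<in> {0..1} \<Longrightarrow> y \<in> {0..1} \<Longrightarrow> logdist x y \<le> ln 2"
  using ln_mono[of "1 + x" 2] ln_mono[of "1 + y" 2] ln_ge_zero[of "1 + x"] ln_ge_zero[of "1 + y"]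
  unfolding logdist_def abs_le_iff atLeastAtMost_iff by linarith

lemma ln_branch_le:
  assumes "x \<in> {0..1}" "y \<in> {0..1}"
  shows "ln (branch n x) - ln (branch n y) \<le> logdist x y"
proof (cases "x \<le> y")
  case True
  have "ln (branch n x) - ln (branch n y) = ln ((real (Suc n) + y) / (real (Suc n) + x))"
    using assms by (simp add: branch_def ln_div)
  also have "\<dots> \<le> ln ((1 + y) / (1 + x))"
    using assms True by (intro ln_mono) (auto simp: field_simps mult_right_mono)
  also have "\<dots> \<le> logdist x y"
    using assms by (simp add: logdist_def ln_div)
  finally show ?thesis .
next
  case False
  then have "branch n x \<le> branch n y"
    using assms by (auto simp: branch_def field_simps)
  then have "ln (branch n x) \<le> ln (branch n y)"
    using branch_pos assms by simp
  then show ?thesis using logdist_nonneg[of x y] by simp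
qed

text \<open>The Gauss map is not uniformly expanding for the Euclidean metric (its slope at 1 is -1), but
  its inverse branches contract \<open>logdist\<close> by a factor 1/2.\<close>

lemma logdist_branch:
  assumes "x \<in> {0..1}" "y \<in> {0..1}"
  shows "logdist (branch n x) (branch n y) \<le> logdist x y / 2"
proof -
  have *: "logdist (branch n x) (branch n y) \<le> logdist x y / 2"
    if xy: "0 \<le> x" "x \<le> y" for x y
  proof -
    let ?w = "real (Suc n)"
    define F where "F z = 1 / 2 * ln (1 + z) + (ln (?w + 1 + z) - ln (?w + z))" for z
    have mono: "F x \<le> F y"
    proof (rule DERIV_nonneg_imp_nondecreasing[OF xy(2)])
      fix z assume z: "x \<le> z" "z \<le> y"
      have w: "?w + 1 + z > 0" "?w + z > 0" "1 + z > 0"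
        using xy z by auto
      have "((\<lambda>z. ln (a + z)) has_real_derivative 1 / (a + z)) (at z)" if "a + z > 0" for a
        using that by (auto intro!: derivative_eq_intros)
      then have "(F has_real_derivative 1 / 2 * (1 / (1 + z)) + (1 / (?w + 1 + z) - 1 / (?w + z))) (at z)"
        unfolding F_def using w by (intro DERIV_add DERIV_cmult DERIV_diff)
      moreover have "0 \<le> 1 / 2 * (1 / (1 + z)) + (1 / (?w + 1 + z) - 1 / (?w + z))"
      proof -
        have "2 * (1 + z) \<le> (?w + 1 + z) * (?w + z)"
          using xy z by (intro mult_mono) auto
        then have "1 / ((?w + 1 + z) * (?w + z)) \<le> 1 / (2 * (1 + z))"
          using xy z by (intro divide_left_mono) auto
        also have "\<dots> = 1 / 2 * (1 / (1 + z))" by simp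
        finally have "1 / ((?w + 1 + z) * (?w + z)) \<le> 1 / 2 * (1 / (1 + z))" .
        moreover have "1 / (?w + 1 + z) - 1 / (?w + z) = - (1 / ((?w + 1 + z) * (?w + z)))"
          using w by (simp add: divide_simps)
        ultimately show ?thesis by linarith
      qed
      ultimately show "\<exists>D. (F has_real_derivative D) (at z) \<and> 0 \<le> D" by blast
    qed
    have eq: "ln (1 + branch n z) = ln (?w + 1 + z) - ln (?w + z)" if "0 \<le> z" for z
    proof -
      have "1 + branch n z = (?w + 1 + z) / (?w + z)"
        using that by (simp add: branch_def divide_simps)
      then show ?thesis using that by (simp add: ln_div)
    qed
    have "0 < branch n y" "branch n y \<le> branch n x"
      using xy by (auto simp: branch_def intro!: divide_left_mono mult_pos_pos)
    then have "ln (1 + branch n y) \<le> ln (1 + branch n x)"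
      by simp
    then have "logdist (branch n x) (branch n y) = ln (1 + branch n x) - ln (1 + branch n y)"
      by (simp add: logdist_def)
    moreover have "logdist x y = ln (1 + y) - ln (1 + x)"
      using xy ln_mono[of "1 + x" "1 + y"] by (simp add: logdist_def)
    ultimately show ?thesis
      using mono eq[of x] eq[of y] xy unfolding F_def by linarith
  qed
  show ?thesis
  proof (cases "x \<le> y")
    case False
    then show ?thesis
      using *[of y x] assms logdist_commute[of x y] logdist_commute[of "branch n x"] by simp
  qed (use * assms in simp)
qed

definition logcone :: "real \<Rightarrow> (real \<Rightarrow> real) set" where
  "logcone K = {f. (\<forall>x\<in>{0..1}. 0 \<le> f x) \<and>
     (\<forall>x\<in>{0..1}. \<forall>y\<in>{0..1}. f x \<le> exp (K * logdist x y) * f y)}"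

lemma logconeI:
  "(\<And>x. x \<in> {0..1} \<Longrightarrow> 0 \<le> f x) \<Longrightarrow>
   (\<And>x y. x \<in> {0..1} \<Longrightarrow> y \<in> {0..1} \<Longrightarrow> f x \<le> exp (K * logdist x y) * f y) \<Longrightarrow> f \<in> logcone K"
  by (simp add: logcone_def)

lemma logcone_nonneg: "f \<in> logcone K \<Longrightarrow> x \<in> {0..1} \<Longrightarrow> 0 \<le> f x"
  by (simp add: logcone_def)

lemma logconeD: "f \<in> logcone K \<Longrightarrow> x \<in> {0..1} \<Longrightarrow> y \<in> {0..1} \<Longrightarrow> f x \<le> exp (K * logdist x y) * f y"
  by (simp add: logcone_def)

lemma logcone_cong: "f \<in> logcone K \<Longrightarrow> (\<And>x. x \<in> {0..1} \<Longrightarrow> f x = g x) \<Longrightarrow> g \<in> logcone K"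
  unfolding logcone_def by simp

lemma logcone_mono:
  assumes "f \<in> logcone K" "K \<le> K'"
  shows "f \<in> logcone K'"
proof (rule logconeI)
  fix x y :: real assume xy: "x \<in> {0..1}" "y \<in> {0..1}"
  have "f x \<le> exp (K * logdist x y) * f y" using logconeD[OF assms(1) xy] .
  also have "\<dots> \<le> exp (K' * logdist x y) * f y"
    using assms xy by (intro mult_right_mono logcone_nonneg[OF assms(1)]) (auto intro: mult_right_mono logdist_nonneg)
  finally show "f x \<le> exp (K' * logdist x y) * f y" .
qed (use assms logcone_nonneg in blast)

lemma logcone_harnack:
  assumes "f \<in> logcone K" "0 \<le> K" "x \<in> {0..1}" "y \<in> {0..1}"
  shows "f x \<le> exp (K * ln 2) * f y"
proof -
  have "f x \<le> exp (K * logdist x y) * f y" using logconeD assms by blast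
  also have "\<dots> \<le> exp (K * ln 2) * f y"
    using assms mult_left_mono[OF logdist_le[OF assms(3,4)] assms(2)]
    by (intro mult_right_mono logcone_nonneg[OF assms(1)]) auto
  finally show ?thesis .
qed

lemma logcone_pos:
  assumes "f \<in> logcone K" "0 < f 0" "x \<in> {0..1}"
  shows "0 < f x"
proof -
  have "f 0 \<le> exp (K * logdist 0 x) * f x" using assms by (intro logconeD) auto
  then show ?thesis using assms(2) by (smt (verit) exp_gt_zero mult_nonneg_nonpos)
qed

lemma logcone_bounded:
  assumes "f \<in> logcone K" "0 \<le> K"
  shows "bounded (f ` {0..1})"
  unfolding bounded_iff
proof (intro exI ballI)
  fix z assume "z \<in> f ` {0..1}"
  then show "norm z \<le> exp (K * ln 2) * f 0"
    using logcone_harnack[OF assms, of _ 0] logcone_nonneg[OF assms(1)] by auto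
qed

lemma logcone_scale: "f \<in> logcone K \<Longrightarrow> 0 \<le> c \<Longrightarrow> (\<lambda>x. c * f x) \<in> logcone K"
  unfolding logcone_def by (simp add: mult.left_commute[of _ c] mult_left_mono)

lemma one_in_logcone: "0 \<le> K \<Longrightarrow> (\<lambda>_. 1) \<in> logcone K"
  by (auto simp: logcone_def logdist_nonneg)

lemma branch_powr_cone:
  assumes "x \<in> {0..1}" "y \<in> {0..1}" "0 \<le> s"
  shows "branch n x powr (2 * s) \<le> exp (2 * s * logdist x y) * branch n y powr (2 * s)"
proof -
  have "2 * s * ln (branch n x) \<le> 2 * s * (logdist x y + ln (branch n y))"
    using ln_branch_le[OF assms(1,2), of n] assms(3) by (intro mult_left_mono) auto
  then show ?thesis
    using branch_pos[OF assms(1), of n] branch_pos[OF assms(2), of n]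
    by (simp add: powr_def exp_add[symmetric] algebra_simps)
qed

lemma logcone_branch:
  assumes "f \<in> logcone K" "0 \<le> K" "x \<in> {0..1}" "y \<in> {0..1}"
  shows "f (branch n x) \<le> exp (K / 2 * logdist x y) * f (branch n y)"
proof -
  have "f (branch n x) \<le> exp (K * logdist (branch n x) (branch n y)) * f (branch n y)"
    using assms by (intro logconeD branch_mem)
  also have "\<dots> \<le> exp (K / 2 * logdist x y) * f (branch n y)"
    using assms mult_left_mono[OF logdist_branch[OF assms(3,4), of n] assms(2)]
    by (intro mult_right_mono logcone_nonneg[OF assms(1)] branch_mem) auto
  finally show ?thesis .
qed

lemma branch_weight_cone:
  assumes "f \<in> logcone K" "0 \<le> K" "0 \<le> s" "x \<in> {0..1}" "y \<in> {0..1}"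
  shows "branch n x powr (2 * s) * f (branch n x)
    \<le> exp ((2 * s + K / 2) * logdist x y) * (branch n y powr (2 * s) * f (branch n y))"
proof -
  have "branch n x powr (2 * s) * f (branch n x)
    \<le> (exp (2 * s * logdist x y) * branch n y powr (2 * s)) * (exp (K / 2 * logdist x y) * f (branch n y))"
    using assms by (intro mult_mono branch_powr_cone logcone_branch) (auto intro: logcone_nonneg branch_mem simp del: atLeastAtMost_iff)
  then show ?thesis by (simp add: exp_add algebra_simps)
qed

lemma suminf_cone:
  assumes "\<And>x. x \<in> {0..1} \<Longrightarrow> summable (\<lambda>n. a n x)" "\<And>n. a n \<in> logcone K"
  shows "(\<lambda>x. \<Sum>n. a n x) \<in> logcone K"
proof (rule logconeI)
  fix x y :: real assume xy: "x \<in> {0..1}" "y \<in> {0..1}"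
  have "(\<Sum>n. a n x) \<le> (\<Sum>n. exp (K * logdist x y) * a n y)"
    by (rule suminf_le[OF logconeD[OF assms(2) xy] assms(1)[OF xy(1)] summable_mult[OF assms(1)[OF xy(2)]]])
  also have "\<dots> = exp (K * logdist x y) * (\<Sum>n. a n y)"
    by (rule suminf_mult[OF assms(1)[OF xy(2)]])
  finally show "(\<Sum>n. a n x) \<le> exp (K * logdist x y) * (\<Sum>n. a n y)" .
next
  fix x :: real assume x: "x \<in> {0..1}"
  show "0 \<le> (\<Sum>n. a n x)"
    by (rule suminf_nonneg[OF assms(1)[OF x] logcone_nonneg[OF assms(2) x]])
qed

lemma transfer_cone:
  assumes "f \<in> logcone K" "0 \<le> K" "s > 1 / 2"
  shows "transfer s f \<in> logcone (2 * s + K / 2)"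
proof -
  have "(\<lambda>x. branch n x powr (2 * s) * f (branch n x)) \<in> logcone (2 * s + K / 2)" for n
    using assms by (intro logconeI branch_weight_cone[OF assms(1)] mult_nonneg_nonneg logcone_nonneg[OF assms(1)] branch_mem) auto
  then show ?thesis
    unfolding transfer_def[abs_def]
    using assms(3) by (intro suminf_cone summable_transfer logcone_bounded[OF assms(1,2)])
qed

lemma transfer_cone_contract:
  assumes "f \<in> logcone K" "8 * s \<le> K" "s > 1 / 2"
  shows "transfer s f \<in> logcone (3 / 4 * K)"
  by (rule logcone_mono[OF transfer_cone[OF assms(1) _ assms(3)]]) (use assms(2,3) in auto)

text \<open>With \<open>z = exp (K * logdist x y / 4)\<close> the claim reduces to \<open>z\<^sup>7 - 1 \<le> 7 z\<^sup>6 (z - 1)\<close>; this is where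
  the constant 7 comes from.\<close>

lemma logcone_diff:
  assumes F: "F \<in> logcone (3 / 4 * K)" and G: "G \<in> logcone (3 / 4 * K)" and K: "0 \<le> K"
    and e: "0 \<le> e" and le: "\<And>y. y \<in> {0..1} \<Longrightarrow> 7 * e * G y \<le> F y"
  shows "(\<lambda>x. F x - e * G x) \<in> logcone K"
proof (rule logconeI)
  fix x :: real assume x: "x \<in> {0..1}"
  have "0 \<le> e * G x" using e logcone_nonneg[OF G x] by simp
  then show "0 \<le> F x - e * G x" using le[OF x] by linarith
next
  fix x y :: real assume x: "x \<in> {0..1}" and y: "y \<in> {0..1}"
  define z where "z = exp (K / 4 * logdist x y)"
  have z1: "1 \<le> z" using K logdist_nonneg[of x y] by (simp add: z_def)
  have z3: "z ^ 3 = exp (3 / 4 * K * logdist x y)" and z4: "z ^ 4 = exp (K * logdist x y)"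
    by (simp_all add: z_def exp_of_nat_mult[symmetric])
  have Fx: "F x \<le> z ^ 3 * F y" using logconeD[OF F x y] z3 by simp
  have Gy: "G y \<le> z ^ 3 * G x" using logconeD[OF G y x] z3 by (simp add: logdist_commute)
  have G0: "0 \<le> e * G y" using e logcone_nonneg[OF G y] by simp
  have pz: "z ^ 7 - 1 \<le> 7 * z ^ 6 * (z - 1)"
  proof -
    have "z ^ 7 - 1 = (z - 1) * (\<Sum>i<7. z ^ i)"
      by (rule power_diff_1_eq)
    also have "\<dots> \<le> (z - 1) * (\<Sum>i<(7::nat). z ^ 6)"
      using z1 by (intro mult_left_mono sum_mono power_increasing) auto
    finally show ?thesis by (simp add: mult_ac)
  qed
  have "0 \<le> (7 * z ^ 6 * (z - 1) - (z ^ 7 - 1)) * (e * G y)"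
    using pz G0 by (intro mult_nonneg_nonneg[OF _ G0]) simp
  also have "\<dots> = z ^ 3 * ((z ^ 4 - z ^ 3) * (7 * e * G y)) - z ^ 3 * (z ^ 4 * (e * G y)) + e * G y"
    by (simp add: algebra_simps flip: power_add) (simp add: eval_nat_numeral algebra_simps)
  also have "\<dots> \<le> z ^ 3 * ((z ^ 4 - z ^ 3) * F y) - z ^ 3 * (z ^ 4 * (e * G y)) + e * (z ^ 3 * G x)"
    using z1 le[OF y] Gy e by (intro add_mono diff_mono mult_left_mono order.refl) (auto intro: power_increasing)
  also have "\<dots> = z ^ 3 * (z ^ 4 * (F y - e * G y) - (z ^ 3 * F y - e * G x))"
    by (simp add: algebra_simps)
  also have "\<dots> \<le> z ^ 3 * (z ^ 4 * (F y - e * G y) - (F x - e * G x))"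
    using Fx z1 by (intro mult_left_mono) auto
  finally show "F x - e * G x \<le> exp (K * logdist x y) * (F y - e * G y)"
    using z1 z4 by (simp add: zero_le_mult_iff)
qed

definition contraction_gap :: "real \<Rightarrow> real" where
  "contraction_gap K = exp (- (3 / 2 * K * ln 2)) / 14"

lemma contraction_gap_bounds: "0 < contraction_gap K" "0 \<le> K \<Longrightarrow> contraction_gap K < 1"
proof -
  show "contraction_gap K < 1" if "0 \<le> K"
  proof -
    have "exp (- (3 / 2 * K * ln 2)) \<le> 1" using that by simp
    then show ?thesis unfolding contraction_gap_def by linarith
  qed
qed (simp add: contraction_gap_def)

text \<open>If \<open>F\<close> carries at least half of \<open>F + G\<close> at 0, \<open>logcone_harnack\<close> makes it carry a fixed
  fraction everywhere.\<close>

lemma logcone_half: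
  assumes F: "F \<in> logcone (3 / 4 * K)" and H: "H \<in> logcone (3 / 4 * K)" and K: "0 \<le> K"
    and half: "d * H 0 \<le> 2 * F 0" and d: "0 \<le> d"
  shows "(\<lambda>x. F x - contraction_gap K * d * H x) \<in> logcone K"
proof (rule logcone_diff[OF F H K])
  show "0 \<le> contraction_gap K * d"
    using contraction_gap_bounds(1)[of K] d by simp
  fix y :: real assume y: "y \<in> {0..1}"
  define m where "m = exp (3 / 4 * K * ln 2)"
  have m: "m > 0" "exp (- (3 / 2 * K * ln 2)) = 1 / m\<^sup>2"
    by (simp_all add: m_def exp_minus field_simps flip: exp_of_nat_mult)
  have "H y \<le> m * H 0" "F 0 \<le> m * F y"
    using logcone_harnack[OF H _ y, of 0] logcone_harnack[OF F _ _ y, of 0] K by (auto simp: m_def)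
  then have "d * H y \<le> d * (m * H 0)" "m * F 0 \<le> m * (m * F y)"
    using d m(1) by (auto intro: mult_left_mono)
  moreover have "m * (d * H 0) \<le> m * (2 * F 0)"
    using half m(1) by (intro mult_left_mono) auto
  ultimately have "d * H y \<le> 2 * m\<^sup>2 * F y"
    by (simp add: power2_eq_square algebra_simps)
  then show "7 * (contraction_gap K * d) * H y \<le> F y"
    using m unfolding contraction_gap_def m(2) by (simp add: divide_simps mult_ac)
qed

lemma birkhoff_step:
  assumes s: "s > 1 / 2" and K: "8 * s \<le> K" and f: "f \<in> logcone K" and g: "g \<in> logcone K"
    and ab: "a \<le> b" and lo: "(\<lambda>x. f x - a * g x) \<in> logcone K" and hi: "(\<lambda>x. b * g x - f x) \<in> logcone K"
  obtains a' b' where "a \<le> a'" "b' \<le> b" "b' - a' = (1 - contraction_gap K) * (b - a)"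
    "(\<lambda>x. transfer s f x - a' * transfer s g x) \<in> logcone K"
    "(\<lambda>x. b' * transfer s g x - transfer s f x) \<in> logcone K"
proof -
  have K0: "0 \<le> K" using s K by simp
  note bf = logcone_bounded[OF f K0] and bg = logcone_bounded[OF g K0]
  define F G H where "F = (\<lambda>x. transfer s f x - a * transfer s g x)"
    and "G = (\<lambda>x. b * transfer s g x - transfer s f x)" and "H = transfer s g"
  have F: "F \<in> logcone (3 / 4 * K)"
    using transfer_cone_contract[OF lo K s]
    by (rule logcone_cong) (simp add: F_def transfer_diff[OF s bf bounded_scale[OF bg]] transfer_scale[OF s bg] del: atLeastAtMost_iff)
  have G: "G \<in> logcone (3 / 4 * K)"
    using transfer_cone_contract[OF hi K s]
    by (rule logcone_cong) (simp add: G_def transfer_diff[OF s bounded_scale[OF bg] bf] transfer_scale[OF s bg] del: atLeastAtMost_iff)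
  have H: "H \<in> logcone (3 / 4 * K)"
    unfolding H_def by (rule transfer_cone_contract[OF g K s])
  have FK: "F \<in> logcone K" and GK: "G \<in> logcone K"
    using F G K0 by (auto elim: logcone_mono)
  let ?e = "contraction_gap K"
  have sum: "(b - a) * H 0 = F 0 + G 0"
    by (simp add: F_def G_def H_def algebra_simps)
  have e: "0 \<le> ?e * (b - a)" using ab contraction_gap_bounds(1)[of K] by simp
  show thesis
  proof (cases "G 0 \<le> F 0")
    case True
    then have "(\<lambda>x. F x - ?e * (b - a) * H x) \<in> logcone K"
      using sum ab by (intro logcone_half F H K0) auto
    then have "(\<lambda>x. transfer s f x - (a + ?e * (b - a)) * transfer s g x) \<in> logcone K"
      by (simp add: F_def H_def algebra_simps)
    then show thesis
      using that[of "a + ?e * (b - a)" b] GK e by (simp add: G_def algebra_simps)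
  next
    case False
    then have "(\<lambda>x. G x - ?e * (b - a) * H x) \<in> logcone K"
      using sum ab by (intro logcone_half G H K0) auto
    then have "(\<lambda>x. (b - ?e * (b - a)) * transfer s g x - transfer s f x) \<in> logcone K"
      by (simp add: G_def H_def algebra_simps)
    then show thesis
      using that[of a "b - ?e * (b - a)"] FK e by (simp add: F_def algebra_simps)
  qed
qed

lemma transfer_funpow_cone:
  assumes "s > 1 / 2" "8 * s \<le> K" "f \<in> logcone (3 / 4 * K)"
  shows "(transfer s ^^ n) f \<in> logcone (3 / 4 * K)"
proof (induction n)
  case (Suc n)
  then have "(transfer s ^^ n) f \<in> logcone K"
    using assms by (elim logcone_mono) simp
  then show ?case using transfer_cone_contract assms by simp
qed (use assms in simp)

lemma transfer_iterates_converge: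
  assumes s: "s > 1 / 2" and K: "8 * s \<le> K"
    and f: "f \<in> logcone (3 / 4 * K)" and g: "g \<in> logcone (3 / 4 * K)" "0 < g 0"
  obtains c D where "0 \<le> D"
    "\<And>n x. x \<in> {0..1} \<Longrightarrow> \<bar>(transfer s ^^ n) f x - c * (transfer s ^^ n) g x\<bar>
        \<le> (1 - contraction_gap K) ^ n * D * (transfer s ^^ n) g x"
proof -
  have K0: "0 \<le> K" and K34: "3 / 4 * K \<le> K" "0 \<le> 3 / 4 * K" using s K by auto
  define m where "m = exp (3 / 4 * K * ln 2)"
  have m: "m > 0" by (simp add: m_def)
  define e where "e = g 0 / (7 * m\<^sup>2 * (f 0 + 1))"
  have f0: "0 \<le> f 0" using logcone_nonneg[OF f] by simp
  have e: "e > 0" using f0 g m by (simp add: e_def)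
  have "7 * e * f y \<le> g y" if y: "y \<in> {0..1}" for y
  proof -
    have fy: "f y \<le> m * f 0" and gy: "g 0 \<le> m * g y"
      using logcone_harnack[OF f K34(2) y, of 0] logcone_harnack[OF g(1) K34(2) _ y, of 0] by (auto simp: m_def)
    have "7 * e * f y \<le> 7 * e * (m * (f 0 + 1))"
      using fy e m by (intro mult_left_mono) (auto simp: algebra_simps)
    also have "\<dots> = g 0 / m"
      using m f0 by (simp add: e_def power2_eq_square divide_simps)
    also have "\<dots> \<le> g y" using gy m by (simp add: field_simps)
    finally show ?thesis .
  qed
  then have "(\<lambda>x. g x - e * f x) \<in> logcone K"
    using e by (intro logcone_diff[OF g(1) f K0]) auto
  from logcone_scale[OF this, of "1 / e"] have b0: "(\<lambda>x. 1 / e * g x - f x) \<in> logcone K"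
    using e by (simp add: right_diff_distrib)
  have fK: "(transfer s ^^ n) f \<in> logcone K" and gK: "(transfer s ^^ n) g \<in> logcone K" for n
    using logcone_mono[OF transfer_funpow_cone[OF s K f] K34(1)]
      logcone_mono[OF transfer_funpow_cone[OF s K g(1)] K34(1)] by auto
  let ?r = "1 - contraction_gap K"
  have r: "0 \<le> ?r" "?r < 1" using contraction_gap_bounds[of K] K0 by auto
  define P where "P n p \<longleftrightarrow> snd p - fst p = ?r ^ n * (1 / e)
      \<and> (\<lambda>x. (transfer s ^^ n) f x - fst p * (transfer s ^^ n) g x) \<in> logcone K
      \<and> (\<lambda>x. snd p * (transfer s ^^ n) g x - (transfer s ^^ n) f x) \<in> logcone K" for n :: nat and p
  have "\<exists>p. \<forall>n. P n (p n) \<and> (fst (p n) \<le> fst (p (Suc n)) \<and> snd (p (Suc n)) \<le> snd (p n))"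
  proof (rule dependent_nat_choice)
    have "P 0 (0, 1 / e)"
      using b0 fK[of 0] by (simp add: P_def)
    then show "\<exists>p. P 0 p" ..
  next
    fix p n assume p: "P n p"
    have "0 \<le> ?r ^ n * (1 / e)" using r e by simp
    then have "fst p \<le> snd p" using p by (simp add: P_def)
    with p obtain a' b' where "fst p \<le> a'" "b' \<le> snd p" "b' - a' = ?r * (snd p - fst p)"
      "(\<lambda>x. transfer s ((transfer s ^^ n) f) x - a' * transfer s ((transfer s ^^ n) g) x) \<in> logcone K"
      "(\<lambda>x. b' * transfer s ((transfer s ^^ n) g) x - transfer s ((transfer s ^^ n) f) x) \<in> logcone K"
      using birkhoff_step[OF s K fK[of n] gK[of n], of "fst p" "snd p"] unfolding P_def by blast
    then have "P (Suc n) (a', b') \<and> fst p \<le> fst (a', b') \<and> snd (a', b') \<le> snd p"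
      using p by (simp add: P_def)
    then show "\<exists>q. P (Suc n) q \<and> (fst p \<le> fst q \<and> snd q \<le> snd p)" by blast
  qed
  then obtain p where p: "\<And>n. P n (p n)"
    and inc: "\<And>n. fst (p n) \<le> fst (p (Suc n))" and dec: "\<And>n. snd (p (Suc n)) \<le> snd (p n)" by blast
  have incs: "incseq (\<lambda>n. fst (p n))" and decs: "decseq (\<lambda>n. snd (p n))"
    using inc dec by (auto intro: incseq_SucI decseq_SucI)
  have le: "fst (p n) \<le> snd (p n)" for n
    using p[of n] mult_nonneg_nonneg[OF zero_le_power[OF r(1), of n], of "1 / e"] e unfolding P_def by simp
  have le2: "fst (p n) \<le> snd (p k)" for n k
    using le[of "max n k"] incseqD[OF incs, of n "max n k"] decseqD[OF decs, of k "max n k"] by simp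
  define c where "c = (SUP n. fst (p n))"
  have bdd: "bdd_above (range (\<lambda>n. fst (p n)))" unfolding bdd_above_def using le2[of _ 0] by blast
  have c: "fst (p n) \<le> c" "c \<le> snd (p n)" for n
    unfolding c_def by (auto intro: cSUP_upper[OF _ bdd] cSUP_least le2)
  show thesis
  proof (rule that[of "1 / e" c])
    fix n and x :: real assume x: "x \<in> {0..1}"
    let ?G = "(transfer s ^^ n) g x"
    have G0: "0 \<le> ?G" using logcone_nonneg[OF gK x] .
    have "fst (p n) * ?G \<le> (transfer s ^^ n) f x" "(transfer s ^^ n) f x \<le> snd (p n) * ?G"
      using p[of n] logcone_nonneg[OF _ x] unfolding P_def by fastforce+
    moreover have "fst (p n) * ?G \<le> c * ?G" "c * ?G \<le> snd (p n) * ?G"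
      using c G0 by (auto intro: mult_right_mono)
    moreover have "snd (p n) * ?G - fst (p n) * ?G = ?r ^ n * (1 / e) * ?G"
      using p[of n] unfolding P_def by (metis left_diff_distrib)
    ultimately show "\<bar>(transfer s ^^ n) f x - c * ?G\<bar> \<le> ?r ^ n * (1 / e) * ?G"
      by (simp add: abs_le_iff)
  qed (use e in simp)
qed

section \<open>The leading eigenpair\<close>

definition eigenpair :: "real \<Rightarrow> real \<Rightarrow> (real \<Rightarrow> real) \<Rightarrow> bool" where
  "eigenpair s l h \<longleftrightarrow> 0 < l \<and> h \<in> logcone (6 * s) \<and> h 0 = 1 \<and> (\<forall>x\<in>{0..1}. transfer s h x = l * h x)"

lemma geometric_increments_converge:
  fixes a :: "nat \<Rightarrow> real"
  assumes r: "0 \<le> r" "r < 1" and inc: "\<And>n. \<bar>a (Suc n) - a n\<bar> \<le> E * r ^ n"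
  obtains l where "a \<longlonglongrightarrow> l" "\<And>n. \<bar>l - a n\<bar> \<le> E * r ^ n / (1 - r)"
proof -
  have E: "0 \<le> E" using inc[of 0] by simp
  have "summable (\<lambda>n. E * r ^ n)" using r by (intro summable_mult summable_geometric) simp
  then have "summable (\<lambda>n. a (Suc n) - a n)"
    by (rule summable_comparison_test') (use inc in simp)
  then have "convergent (\<lambda>n. a n - a 0)"
    by (simp add: summable_iff_convergent sum_lessThan_telescope)
  then have "convergent a"
    by (simp add: convergent_diff_const_right_iff)
  then obtain l where l: "a \<longlonglongrightarrow> l" by (auto simp: convergent_def)
  have partial: "\<bar>a (m + n) - a n\<bar> \<le> E * r ^ n * (1 - r ^ m) / (1 - r)" for m n
  proof (induction m)
    case (Suc m)
    have "\<bar>a (Suc m + n) - a n\<bar> \<le> E * r ^ (m + n) + E * r ^ n * (1 - r ^ m) / (1 - r)"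
      using inc[of "m + n"] Suc by simp
    also have "\<dots> = E * r ^ n * (1 - r ^ Suc m) / (1 - r)"
      using r by (simp add: field_simps power_add)
    finally show ?case .
  qed simp
  have "\<bar>l - a n\<bar> \<le> E * r ^ n / (1 - r)" for n
  proof (rule LIMSEQ_le_const2)
    show "(\<lambda>m. \<bar>a (m + n) - a n\<bar>) \<longlonglongrightarrow> \<bar>l - a n\<bar>"
      by (intro tendsto_intros LIMSEQ_ignore_initial_segment l)
    have "E * r ^ n * (1 - r ^ m) / (1 - r) \<le> E * r ^ n / (1 - r)" for m
      using r E by (intro divide_right_mono mult_left_le) auto
    then show "\<exists>N. \<forall>m\<ge>N. \<bar>a (m + n) - a n\<bar> \<le> E * r ^ n / (1 - r)"
      using partial order.trans by blast
  qed
  with l show thesis using that by blast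
qed

lemma logcone_limit:
  assumes "\<And>n. f n \<in> logcone K" "\<And>x. x \<in> {0..1} \<Longrightarrow> (\<lambda>n. f n x) \<longlonglongrightarrow> h x"
  shows "h \<in> logcone K"
proof (rule logconeI)
  show "0 \<le> h x" if "x \<in> {0..1}" for x
    using logcone_nonneg[OF assms(1) that] by (intro LIMSEQ_le_const[OF assms(2)[OF that]]) auto
  show "h x \<le> exp (K * logdist x y) * h y" if "x \<in> {0..1}" "y \<in> {0..1}" for x y
    using logconeD[OF assms(1) that]
    by (intro LIMSEQ_le[OF assms(2)[OF that(1)] tendsto_mult_left[OF assms(2)[OF that(2)]]]) auto
qed

lemma transfer_ge_term:
  assumes s: "s > 1 / 2" and f: "f \<in> logcone K" and K: "0 \<le> K" and x: "x \<in> {0..1}"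
  shows "branch n x powr (2 * s) * f (branch n x) \<le> transfer s f x"
proof -
  have "(\<Sum>k\<in>{n}. branch k x powr (2 * s) * f (branch k x)) \<le> transfer s f x"
    unfolding transfer_def
    by (intro sum_le_suminf summable_transfer s x logcone_bounded[OF f K] mult_nonneg_nonneg
        logcone_nonneg[OF f] branch_mem) auto
  then show ?thesis by simp
qed

lemma transfer_zero_ge:
  assumes s: "s > 1 / 2" and f: "f \<in> logcone K" and K: "0 \<le> K"
  shows "exp (- (K * ln 2)) * f 0 \<le> transfer s f 0"
proof -
  have "f 0 \<le> exp (K * ln 2) * f 1" using logcone_harnack[OF f K, of 0 1] by simp
  then have "exp (- (K * ln 2)) * f 0 \<le> f 1" by (simp add: exp_minus field_simps)
  also have "f 1 \<le> transfer s f 0"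
    using transfer_ge_term[OF s f K, of 0 0] by (simp add: branch_def)
  finally show ?thesis .
qed

lemma eigenpair_exists:
  assumes s: "s > 1 / 2"
  obtains l h where "eigenpair s l h"
proof -
  define u where "u n = (transfer s ^^ n) (\<lambda>_. 1)" for n
  have K: "8 * s \<le> 8 * s" "0 \<le> 6 * s" "3 / 4 * (8 * s) = 6 * s" using s by auto
  have one: "(\<lambda>_. 1) \<in> logcone (3 / 4 * (8 * s))" using s by (intro one_in_logcone) simp
  have u: "u n \<in> logcone (6 * s)" for n
    using transfer_funpow_cone[OF s K(1) one] K(3) by (simp add: u_def)
  have uS: "u (Suc n) = transfer s (u n)" for n by (simp add: u_def)
  define q where "q = exp (- (6 * s * ln 2))"
  have q: "q > 0" by (simp add: q_def)
  have step: "q * u n 0 \<le> u (Suc n) 0" for n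
    unfolding q_def uS by (rule transfer_zero_ge[OF s u K(2)])
  have u0: "0 < u n 0" for n
  proof (induction n)
    case (Suc n)
    then show ?case using step[of n] mult_pos_pos[OF q Suc] by simp
  qed (simp add: u_def)
  have u1: "u 1 \<in> logcone (3 / 4 * (8 * s))" using u[of 1] K(3) by simp
  define r where "r = 1 - contraction_gap (8 * s)"
  have r: "0 \<le> r" "r < 1" using contraction_gap_bounds[of "8 * s"] s by (auto simp: r_def)
  obtain c D where D: "0 \<le> D" and
    conv: "\<And>n x. x \<in> {0..1} \<Longrightarrow> \<bar>(transfer s ^^ n) (u 1) x - c * (transfer s ^^ n) (\<lambda>_. 1) x\<bar>
        \<le> (1 - contraction_gap (8 * s)) ^ n * D * (transfer s ^^ n) (\<lambda>_. 1) x"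
    using transfer_iterates_converge[OF s K(1) u1 one zero_less_one] by metis
  have "(transfer s ^^ n) (u 1) = u (Suc n)" for n
    by (simp add: u_def funpow_swap1)
  then have uc: "\<bar>u (Suc n) x - c * u n x\<bar> \<le> r ^ n * D * u n x" if "x \<in> {0..1}" for n x
    using conv[OF that, of n] by (simp add: u_def r_def)
  define v where "v n x = u n x / u n 0" for n x
  define p where "p n = u (Suc n) 0 / u n 0" for n
  have pq: "q \<le> p n" for n using step[of n] u0[of n] by (simp add: p_def field_simps)
  have pc: "\<bar>p n - c\<bar> \<le> D * r ^ n" for n
  proof -
    have "(p n - c) * u n 0 = u (Suc n) 0 - c * u n 0"
      using u0[of n] by (simp add: p_def field_simps)
    moreover have "\<bar>p n - c\<bar> * u n 0 = \<bar>(p n - c) * u n 0\<bar>"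
      using u0[of n] by (simp add: abs_mult)
    ultimately have "\<bar>p n - c\<bar> * u n 0 \<le> D * r ^ n * u n 0"
      using uc[of 0 n] by (simp add: mult_ac)
    then show ?thesis using u0[of n] by simp
  qed
  have rn: "(\<lambda>n. C * r ^ n) \<longlonglongrightarrow> 0" for C
    using tendsto_mult_right_zero[OF LIMSEQ_realpow_zero[OF r]] by simp
  have plim: "p \<longlonglongrightarrow> c"
    by (rule Lim_transform2[OF tendsto_const])
       (rule Lim_null_comparison[OF _ rn[of D]], use pc in \<open>simp add: abs_minus_commute\<close>)
  have "q \<le> c" using LIMSEQ_le_const[OF plim] pq by blast
  then have c: "0 < c" using q by simp
  define m where "m = exp (6 * s * ln 2)"
  have v: "v n \<in> logcone (6 * s)" for n
    using logcone_scale[OF u[of n], of "1 / u n 0"] u0[of n] by (simp add: v_def[abs_def])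
  have v0: "v n 0 = 1" for n using u0[of n] by (simp add: v_def)
  have vm: "0 \<le> v n x" "v n x \<le> m" if "x \<in> {0..1}" for n x
    using logcone_nonneg[OF v that] logcone_harnack[OF v K(2) that, of 0 n] v0[of n] by (auto simp: m_def)
  have pv: "p n * v (Suc n) x = u (Suc n) x / u n 0" for n x
    using u0[of n] u0[of "Suc n"] by (simp add: p_def v_def)
  have inc: "\<bar>v (Suc n) x - v n x\<bar> \<le> 2 * D * m / q * r ^ n" if x: "x \<in> {0..1}" for n x
  proof -
    have "q * \<bar>v (Suc n) x - v n x\<bar> \<le> p n * \<bar>v (Suc n) x - v n x\<bar>"
      using pq by (intro mult_right_mono) auto
    also have "\<dots> = \<bar>p n * v (Suc n) x - p n * v n x\<bar>"
      using pq[of n] q by (simp add: abs_mult flip: right_diff_distrib)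
    also have "\<dots> = \<bar>(u (Suc n) x - c * u n x) / u n 0 + (c - p n) * v n x\<bar>"
      unfolding pv by (simp add: v_def diff_divide_distrib algebra_simps)
    also have "\<dots> \<le> \<bar>u (Suc n) x - c * u n x\<bar> / u n 0 + \<bar>c - p n\<bar> * v n x"
      using abs_triangle_ineq[of "(u (Suc n) x - c * u n x) / u n 0" "(c - p n) * v n x"] vm[OF x, of n] u0[of n]
      by (simp add: abs_mult)
    also have "\<dots> \<le> r ^ n * D * v n x + D * r ^ n * v n x"
      using uc[OF x, of n] pc[of n] u0[of n] vm[OF x, of n]
      by (intro add_mono mult_right_mono) (simp_all add: v_def divide_right_mono abs_minus_commute)
    also have "\<dots> = 2 * D * r ^ n * v n x" by simp
    also have "\<dots> \<le> 2 * D * r ^ n * m"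
      using vm[OF x, of n] D r by (intro mult_left_mono) auto
    finally show ?thesis using q by (simp add: field_simps)
  qed
  define E where "E = 2 * D * m / q / (1 - r)"
  have "\<exists>l. (\<lambda>n. v n x) \<longlonglongrightarrow> l \<and> (\<forall>n. \<bar>l - v n x\<bar> \<le> E * r ^ n)" if "x \<in> {0..1}" for x
    by (rule geometric_increments_converge[OF r, of "\<lambda>n. v n x" "2 * D * m / q"])
       (use inc[OF that] in \<open>auto simp: E_def\<close>)
  then obtain h where hl: "\<And>x. x \<in> {0..1} \<Longrightarrow> (\<lambda>n. v n x) \<longlonglongrightarrow> h x"
    and hE: "\<And>x n. x \<in> {0..1} \<Longrightarrow> \<bar>h x - v n x\<bar> \<le> E * r ^ n"
    by metis
  have h: "h \<in> logcone (6 * s)" by (rule logcone_limit[OF v hl])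
  have "h 0 = 1" using LIMSEQ_unique[OF hl[of 0]] v0 by simp
  moreover have "transfer s h x = c * h x" if x: "x \<in> {0..1}" for x
  proof (rule LIMSEQ_unique)
    note bh = logcone_bounded[OF h K(2)] and bv = logcone_bounded[OF v K(2)]
    have "\<bar>transfer s h x - transfer s (v n) x\<bar> \<le> E * transfer s (\<lambda>_. 1) 0 * r ^ n" for n
      using transfer_bound[OF s x, of "\<lambda>y. h y - v n y", OF hE] unfolding transfer_diff[OF s bh bv x] by (simp add: mult_ac)
    then show "(\<lambda>n. transfer s (v n) x) \<longlonglongrightarrow> transfer s h x"
      by (intro Lim_transform2[OF tendsto_const Lim_null_comparison[OF _ rn[of "E * transfer s (\<lambda>_. 1) 0"]]]) simp
    have "transfer s (v n) x = p n * v (Suc n) x" for n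
    proof -
      have "v n = (\<lambda>y. (1 / u n 0) * u n y)" by (simp add: v_def fun_eq_iff)
      then have "transfer s (v n) x = (1 / u n 0) * transfer s (u n) x"
        using transfer_scale[OF s logcone_bounded[OF u K(2)] x] by (simp only:)
      then show ?thesis by (simp add: pv uS)
    qed
    then show "(\<lambda>n. transfer s (v n) x) \<longlonglongrightarrow> c * h x"
      using tendsto_mult[OF plim LIMSEQ_Suc[OF hl[OF x]]] by simp
  qed
  ultimately have "eigenpair s c h" using c h by (simp add: eigenpair_def)
  then show thesis by (rule that)
qed

lemma eigenpair_bounds:
  assumes "eigenpair s l h" "s > 1 / 2" "x \<in> {0..1}"
  shows "h x \<le> exp (6 * s * ln 2)" "exp (- (6 * s * ln 2)) \<le> h x"
  using logcone_harnack[of h "6 * s" x 0] logcone_harnack[of h "6 * s" 0 x] assms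
  by (auto simp: eigenpair_def exp_minus field_simps)

lemma eigenpair_pos: "eigenpair s l h \<Longrightarrow> x \<in> {0..1} \<Longrightarrow> 0 < h x"
  by (rule logcone_pos[of h "6 * s"]) (auto simp: eigenpair_def)

lemma eigenpair_bounded: "eigenpair s l h \<Longrightarrow> s > 1 / 2 \<Longrightarrow> bounded (h ` {0..1})"
  by (rule logcone_bounded[of h "6 * s"]) (auto simp: eigenpair_def)

text \<open>The optimal constant \<open>k\<close> with \<open>f \<le> k g\<close> satisfies \<open>k \<le> k b / a\<close>.\<close>

lemma transfer_comparison:
  assumes s: "s > 1 / 2" and bf: "bounded (f ` {0..1})" and bg: "bounded (g ` {0..1})"
    and f: "\<And>x. x \<in> {0..1} \<Longrightarrow> 0 < f x" and g: "\<And>x. x \<in> {0..1} \<Longrightarrow> d \<le> g x" and d: "0 < d"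
    and a: "0 < a" and fa: "\<And>x. x \<in> {0..1} \<Longrightarrow> a * f x \<le> transfer s f x"
    and gb: "\<And>x. x \<in> {0..1} \<Longrightarrow> transfer s g x \<le> b * g x"
  shows "a \<le> b"
proof -
  obtain C where C: "\<And>x. x \<in> {0..1} \<Longrightarrow> \<bar>f x\<bar> \<le> C"
    using bf unfolding bounded_iff by (metis imageI real_norm_def)
  have g0: "0 < g x" if "x \<in> {0..1}" for x using g[OF that] d by simp
  define k where "k = (SUP x\<in>{0..1}. f x / g x)"
  have "f x / g x \<le> C / d" if x: "x \<in> {0..1}" for x
    using C[OF x] f[OF x] g[OF x] d by (intro frac_le) auto
  then have bdd: "bdd_above ((\<lambda>x. f x / g x) ` {0..1})" by (rule bdd_aboveI2)
  have le: "f x \<le> k * g x" if x: "x \<in> {0..1}" for x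
  proof -
    have "f x / g x \<le> k" unfolding k_def by (rule cSUP_upper[OF x bdd])
    then show ?thesis using g0[OF x] by (simp add: field_simps)
  qed
  have "0 < k * g 0" using le[of 0] f[of 0] by simp
  then have k: "0 < k" using g0[of 0] by (simp add: zero_less_mult_iff)
  have "f x / g x \<le> k * b / a" if x: "x \<in> {0..1}" for x
  proof -
    have "a * f x \<le> transfer s f x" by (rule fa[OF x])
    also have "\<dots> \<le> transfer s (\<lambda>y. k * g y) x"
      by (rule transfer_mono[OF s bf bounded_scale[OF bg] x le])
    also have "\<dots> = k * transfer s g x" by (rule transfer_scale[OF s bg x])
    also have "\<dots> \<le> k * (b * g x)" using k gb[OF x] by (intro mult_left_mono) auto
    finally show ?thesis using a g0[OF x] by (simp add: field_simps)
  qed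
  then have "k \<le> k * b / a" unfolding k_def by (intro cSUP_least) auto
  then show ?thesis using k a by (simp add: field_simps)
qed

section \<open>The pressure is the logarithm of the leading eigenvalue\<close>

definition word_weight :: "real \<Rightarrow> nat list \<Rightarrow> real \<Rightarrow> real" where
  "word_weight s ws x = (\<Prod>j<length ws. cf (drop j ws) x powr (2 * s))"

lemma cf_snoc: "cf (ws @ [Suc n]) x = cf ws (branch n x)"
  by (induction ws) (auto simp: branch_def)

lemma cf_mem: "ws \<in> words n \<Longrightarrow> x \<in> {0..1} \<Longrightarrow> cf ws x \<in> {0..1}"
proof (induction ws arbitrary: n)
  case (Cons w ws)
  then have "cf ws x \<in> {0..1}" "1 \<le> w" by (auto simp: words_def)
  then show ?case by (auto simp: field_simps)
qed simp

lemma word_weight_Nil: "word_weight s [] x = 1"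
  by (simp add: word_weight_def)

lemma word_weight_snoc:
  "word_weight s (ws @ [Suc n]) x = branch n x powr (2 * s) * word_weight s ws (branch n x)"
proof -
  have "cf (drop j ws @ [Suc n]) x = cf (drop j ws) (branch n x)" for j
    by (rule cf_snoc)
  moreover have "cf [Suc n] x = branch n x" by (simp add: branch_def)
  ultimately show ?thesis by (simp add: word_weight_def mult.commute)
qed

lemma words_0: "words 0 = {[]}"
  by (auto simp: words_def)

lemma words_Suc: "words (Suc n) = (\<lambda>(k, ws). ws @ [Suc k]) ` (UNIV \<times> words n)"
proof -
  have "ws \<in> (\<lambda>(k, ws). ws @ [Suc k]) ` (UNIV \<times> words n)" if ws: "ws \<in> words (Suc n)" for ws
  proof -
    have "ws \<noteq> []" using ws by (auto simp: words_def)
    then obtain vs w where vs: "ws = vs @ [w]" by (metis append_butlast_last_id)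
    moreover obtain k where "w = Suc k" using ws vs by (cases w) (auto simp: words_def)
    ultimately have "ws = (\<lambda>(k, ws). ws @ [Suc k]) (k, vs)" "(k, vs) \<in> UNIV \<times> words n"
      using ws by (auto simp: words_def)
    then show ?thesis by (rule image_eqI)
  qed
  moreover have "(\<lambda>(k, ws). ws @ [Suc k]) ` (UNIV \<times> words n) \<subseteq> words (Suc n)"
    by (auto simp: words_def)
  ultimately show ?thesis by blast
qed

lemma word_weight_cone: "s > 0 \<Longrightarrow> ws \<in> words n \<Longrightarrow> word_weight s ws \<in> logcone (4 * s)"
proof (induction n arbitrary: ws)
  case 0
  then show ?case by (simp add: words_0 word_weight_def[abs_def] one_in_logcone)
next
  case (Suc n)
  then obtain k vs where ws: "ws = vs @ [Suc k]" and vs: "vs \<in> words n"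
    by (auto simp: words_Suc)
  have vc: "word_weight s vs \<in> logcone (4 * s)" using Suc vs by blast
  show ?case
  proof (rule logconeI)
    fix x y :: real assume "x \<in> {0..1}" "y \<in> {0..1}"
    then show "word_weight s ws x \<le> exp (4 * s * logdist x y) * word_weight s ws y"
      using branch_weight_cone[OF vc, of s x y k] Suc(2) by (simp add: ws word_weight_snoc)
  qed (simp add: word_weight_def prod_nonneg)
qed

lemma word_weight_pos: "ws \<in> words n \<Longrightarrow> x \<in> {0..1} \<Longrightarrow> 0 < word_weight s ws x"
proof (induction n arbitrary: ws x)
  case 0
  then show ?case by (simp add: words_0 word_weight_Nil)
next
  case (Suc n)
  then obtain k vs where ws: "ws = vs @ [Suc k]" and vs: "vs \<in> words n"
    by (auto simp: words_Suc)
  then show ?case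
    using Suc.IH[OF vs branch_mem[OF Suc.prems(2)], of k] branch_pos[OF Suc.prems(2), of k]
    by (simp add: word_weight_snoc)
qed

lemma word_sum:
  assumes e: "eigenpair s l h" and s: "s > 1 / 2" and x: "x \<in> {0..1}"
  shows "((\<lambda>ws. word_weight s ws x * h (cf ws x)) has_sum l ^ n * h x) (words n)"
  using x
proof (induction n arbitrary: x)
  case 0
  then show ?case
    using has_sum_finite[of "{[]}" "\<lambda>ws. word_weight s ws x * h (cf ws x)"]
    by (simp add: words_0 word_weight_Nil)
next
  case (Suc n)
  let ?f = "\<lambda>ws. word_weight s ws x * h (cf ws x)"
  let ?g = "\<lambda>(k, ws). ws @ [Suc k]"
  let ?a = "\<lambda>k. branch k x powr (2 * s) * (l ^ n * h (branch k x))"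
  have inner: "((\<lambda>ws. (?f \<circ> ?g) (k, ws)) has_sum ?a k) (words n)" for k
    using has_sum_cmult_right[OF Suc.IH[OF branch_mem[OF Suc.prems, of k]], of "branch k x powr (2 * s)"]
    by (simp add: word_weight_snoc cf_snoc mult_ac)
  have nonneg: "0 \<le> (?f \<circ> ?g) (k, ws)" if "ws \<in> words n" for k ws
  proof -
    have "?g (k, ws) \<in> words (Suc n)" using that by (auto simp: words_Suc)
    then show ?thesis
      using word_weight_pos[of _ "Suc n" x] eigenpair_pos[OF e cf_mem, of _ "Suc n" x] Suc.prems
      by (simp add: less_imp_le)
  qed
  have sm: "summable (\<lambda>k. branch k x powr (2 * s) * h (branch k x))"
    by (rule summable_transfer[OF s eigenpair_bounded[OF e s] Suc.prems])
  have "(\<lambda>k. branch k x powr (2 * s) * h (branch k x)) sums (l * h x)"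
    using summable_sums[OF sm] e Suc.prems by (simp add: eigenpair_def transfer_def)
  from sums_mult[OF this, of "l ^ n"] have "?a sums (l ^ Suc n * h x)"
    by (simp add: mult_ac)
  moreover have "0 \<le> ?a k" for k
    using e eigenpair_pos[OF e branch_mem[OF Suc.prems], of k] by (simp add: eigenpair_def less_imp_le)
  ultimately have outer: "(?a has_sum (l ^ Suc n * h x)) UNIV"
    by (rule sums_nonneg_imp_has_sum)
  have "((?f \<circ> ?g) has_sum (l ^ Suc n * h x)) (UNIV \<times> words n)"
    by (rule has_sum_SigmaI[OF inner outer summable_on_SigmaI[OF inner has_sum_imp_summable[OF outer] nonneg]])
  moreover have "inj_on ?g (UNIV \<times> words n)" by (auto intro: inj_onI)
  ultimately show ?case
    unfolding words_Suc by (simp add: has_sum_reindex)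
qed

lemma partition_sum_bounds:
  assumes e: "eigenpair s l h" and s: "s > 1 / 2"
  shows "exp (- (6 * s * ln 2)) * l ^ n \<le> partition_sum n s"
    and "partition_sum n s \<le> exp (10 * s * ln 2) * l ^ n"
proof -
  let ?W = "\<lambda>ws. word_weight s ws 0"
  let ?S = "\<lambda>ws. exp (SUP x\<in>{0..1}. ln (\<Prod>j<n. cf (drop j ws) x powr (2 * s)))"
  let ?h = "\<lambda>ws. ?W ws * h (cf ws 0)"
  have h0: "h 0 = 1" using e by (simp add: eigenpair_def)
  have hs: "(?h has_sum l ^ n) (words n)"
    using word_sum[OF e s, of 0 n] h0 by simp
  have S: "?W ws \<le> ?S ws" "?S ws \<le> exp (4 * s * ln 2) * ?W ws" if ws: "ws \<in> words n" for ws
  proof -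
    have n: "length ws = n" using ws by (simp add: words_def)
    have eq: "(\<Prod>j<n. cf (drop j ws) x powr (2 * s)) = word_weight s ws x" for x
      by (simp add: word_weight_def n)
    have le: "ln (word_weight s ws x) \<le> 4 * s * ln 2 + ln (?W ws)" if x: "x \<in> {0..1}" for x
    proof -
      have "word_weight s ws x \<le> exp (4 * s * ln 2) * ?W ws"
        using s by (intro logcone_harnack[OF word_weight_cone[OF _ ws]] x) auto
      then have "ln (word_weight s ws x) \<le> ln (exp (4 * s * ln 2) * ?W ws)"
        using word_weight_pos[OF ws x] by (rule ln_mono)
      then show ?thesis using word_weight_pos[OF ws, of 0 s] by (simp add: ln_mult)
    qed
    then have "bdd_above ((\<lambda>x. ln (word_weight s ws x)) ` {0..1})" by (rule bdd_aboveI2)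
    then have "ln (?W ws) \<le> (SUP x\<in>{0..1}. ln (word_weight s ws x))"
      by (intro cSUP_upper) auto
    then have "exp (ln (?W ws)) \<le> ?S ws" by (simp add: eq)
    then show "?W ws \<le> ?S ws" using word_weight_pos[OF ws, of 0 s] by simp
    have "?S ws \<le> exp (4 * s * ln 2 + ln (?W ws))"
      unfolding eq exp_le_cancel_iff using le by (intro cSUP_least) auto
    then show "?S ws \<le> exp (4 * s * ln 2) * ?W ws"
      using word_weight_pos[OF ws, of 0 s] by (simp add: exp_add)
  qed
  have W: "exp (- (6 * s * ln 2)) * ?h ws \<le> ?W ws" "?W ws \<le> exp (6 * s * ln 2) * ?h ws" if ws: "ws \<in> words n" for ws
  proof -
    have p: "0 < ?W ws" using word_weight_pos[OF ws] by simp
    have b: "h (cf ws 0) \<le> exp (6 * s * ln 2)" "exp (- (6 * s * ln 2)) \<le> h (cf ws 0)"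
      using eigenpair_bounds[OF e s cf_mem[OF ws, of 0]] by auto
    have "?h ws \<le> ?W ws * exp (6 * s * ln 2)" "?W ws * exp (- (6 * s * ln 2)) \<le> ?h ws"
      using p b by (auto intro: mult_left_mono)
    then show "exp (- (6 * s * ln 2)) * ?h ws \<le> ?W ws" "?W ws \<le> exp (6 * s * ln 2) * ?h ws"
      by (simp_all add: exp_minus field_simps)
  qed
  have upper: "?S ws \<le> exp (10 * s * ln 2) * ?h ws" if ws: "ws \<in> words n" for ws
  proof -
    have "?S ws \<le> exp (4 * s * ln 2) * (exp (6 * s * ln 2) * ?h ws)"
      using S(2)[OF ws] W(2)[OF ws] by (meson exp_ge_zero mult_left_mono order.trans)
    then show ?thesis by (simp add: mult.assoc[symmetric] exp_add[symmetric])
  qed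
  have hsu: "((\<lambda>ws. exp (10 * s * ln 2) * ?h ws) has_sum exp (10 * s * ln 2) * l ^ n) (words n)"
    and hsl: "((\<lambda>ws. exp (- (6 * s * ln 2)) * ?h ws) has_sum exp (- (6 * s * ln 2)) * l ^ n) (words n)"
    by (rule has_sum_cmult_right[OF hs])+
  have "?S summable_on words n"
    by (rule summable_on_comparison_test[OF has_sum_imp_summable[OF hsu] upper]) auto
  then have hS: "(?S has_sum partition_sum n s) (words n)"
    unfolding partition_sum_def by (rule has_sum_infsum)
  show "exp (- (6 * s * ln 2)) * l ^ n \<le> partition_sum n s"
    using W(1) S(1) by (intro has_sum_mono[OF hsl hS]) (meson order.trans)
  show "partition_sum n s \<le> exp (10 * s * ln 2) * l ^ n"
    by (rule has_sum_mono[OF hS hsu upper])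
qed

lemma pressure_eq_ln:
  assumes e: "eigenpair s l h" and s: "s > 1 / 2"
  shows "pressure s = ln l"
proof -
  have l: "0 < l" using e by (simp add: eigenpair_def)
  note b = partition_sum_bounds[OF e s]
  have pos: "0 < partition_sum n s" for n
    using b(1)[of n] l by (smt (verit) exp_gt_zero mult_pos_pos zero_less_power)
  have lo: "- (6 * s * ln 2) + n * ln l \<le> ln (partition_sum n s)" for n
    using ln_mono[OF b(1)[of n]] l by (simp add: ln_mult ln_realpow)
  have hi: "ln (partition_sum n s) \<le> 10 * s * ln 2 + n * ln l" for n
    using ln_mono[OF b(2)[of n] pos] l by (simp add: ln_mult ln_realpow)
  have lim: "(\<lambda>n. ln l + C * (1 / real n)) \<longlonglongrightarrow> ln l" for C
    using tendsto_add[OF tendsto_const tendsto_mult[OF tendsto_const lim_1_over_n], of "ln l" C] by simp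
  have "(\<lambda>n. 1 / real n * ln (partition_sum n s)) \<longlonglongrightarrow> ln l"
  proof (rule tendsto_sandwich[OF _ _ lim[of "- (6 * s * ln 2)"] lim[of "10 * s * ln 2"]])
    have "1 / real n * (C + n * ln l) = ln l + C * (1 / real n)" if "0 < n" for n C
      using that by (simp add: field_simps)
    moreover have "1 / real n * a \<le> 1 / real n * b" if "a \<le> b" for n a b
      using that by (intro mult_left_mono) auto
    ultimately have "ln l + - (6 * s * ln 2) * (1 / real n) \<le> 1 / real n * ln (partition_sum n s)"
      "1 / real n * ln (partition_sum n s) \<le> ln l + 10 * s * ln 2 * (1 / real n)" if "0 < n" for n
      using lo[of n] hi[of n] that by metis+
    then show "\<forall>\<^sub>F n in sequentially. ln l + - (6 * s * ln 2) * (1 / real n) \<le> 1 / real n * ln (partition_sum n s)"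
      "\<forall>\<^sub>F n in sequentially. 1 / real n * ln (partition_sum n s) \<le> ln l + 10 * s * ln 2 * (1 / real n)"
      by (auto intro!: eventually_sequentiallyI[of 1])
  qed
  then show ?thesis unfolding pressure_def by (rule limI)
qed

section \<open>Differentiability of the pressure\<close>

lemma eigenvalue_ge:
  assumes "eigenpair s l h" "s > 1 / 2" "bounded (g ` {0..1})" "\<And>x. x \<in> {0..1} \<Longrightarrow> 0 < g x" "0 < a"
    and "\<And>x. x \<in> {0..1} \<Longrightarrow> a * g x \<le> transfer s g x"
  shows "a \<le> l"
  by (rule transfer_comparison[OF assms(2,3) eigenpair_bounded[OF assms(1,2)] assms(4)
        eigenpair_bounds(2)[OF assms(1,2)] _ assms(5,6)])
     (use assms(1) in \<open>auto simp: eigenpair_def\<close>)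

lemma eigenvalue_le:
  assumes "eigenpair s l h" "s > 1 / 2" "bounded (g ` {0..1})" "\<And>x. x \<in> {0..1} \<Longrightarrow> d \<le> g x" "0 < d"
    and "\<And>x. x \<in> {0..1} \<Longrightarrow> transfer s g x \<le> b * g x"
  shows "l \<le> b"
  by (rule transfer_comparison[OF assms(2) eigenpair_bounded[OF assms(1,2)] assms(3)
        eigenpair_pos[OF assms(1)] assms(4,5) _ _ assms(6)])
     (use assms(1) in \<open>auto simp: eigenpair_def\<close>)

lemma abs_ln_branch_le:
  assumes "x \<in> {0..1}" "0 < a"
  shows "\<bar>ln (branch n x)\<bar> \<le> branch n x powr - a / a"
proof -
  have b: "0 < branch n x" "branch n x \<le> 1" using branch_pos branch_mem assms by auto
  have "ln (1 / branch n x) \<le> (1 / branch n x) powr a / a"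
    using b assms by (intro ln_powr_bound) auto
  then show ?thesis
    using b ln_branch_nonpos[OF assms(1), of n] by (simp add: ln_div powr_divide powr_minus_divide)
qed

lemma summable_transfer_ln:
  assumes s: "s > 1 / 2" and f: "bounded (f ` {0..1})" and x: "x \<in> {0..1}"
  shows "summable (\<lambda>n. branch n x powr (2 * s) * (f (branch n x) * ln (branch n x)))"
proof -
  obtain C where C: "\<And>y. y \<in> {0..1} \<Longrightarrow> \<bar>f y\<bar> \<le> C"
    using f unfolding bounded_iff by (metis imageI real_norm_def)
  have C0: "0 \<le> C" using C[OF x] by linarith
  define a where "a = s - 1 / 2"
  have a: "0 < a" using s by (simp add: a_def)
  show ?thesis
  proof (rule summable_branch_bound[of "s / 2 + 1 / 4", OF _ x])
    fix n
    let ?b = "branch n x"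
    have "\<bar>?b powr (2 * s) * (f ?b * ln ?b)\<bar> = ?b powr (2 * s) * (\<bar>f ?b\<bar> * \<bar>ln ?b\<bar>)"
      by (simp add: abs_mult)
    also have "\<dots> \<le> ?b powr (2 * s) * (C * (?b powr - a / a))"
      using C[OF branch_mem[OF x]] abs_ln_branch_le[OF x a] C0 by (intro mult_left_mono mult_mono) auto
    also have "\<dots> = C / a * (?b powr (2 * s) * ?b powr - a)" by simp
    also have "\<dots> = C / a * ?b powr (2 * (s / 2 + 1 / 4))"
      unfolding powr_add[symmetric] by (simp add: a_def)
    finally show "\<bar>?b powr (2 * s) * (f ?b * ln ?b)\<bar> \<le> C / a * ?b powr (2 * (s / 2 + 1 / 4))" .
  qed (use s in simp)
qed

lemma log_weighted_branch_cone:
  assumes h: "h \<in> logcone K" and K: "0 \<le> K" and s: "0 \<le> s"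
  shows "(\<lambda>x. branch n x powr (2 * s) * ((1 - 2 * ln (branch n x)) * h (branch n x)))
    \<in> logcone (2 * s + K / 2 + 2)"
proof (rule logconeI)
  show "0 \<le> branch n x powr (2 * s) * ((1 - 2 * ln (branch n x)) * h (branch n x))" if "x \<in> {0..1}" for x
    using ln_branch_nonpos[OF that, of n] logcone_nonneg[OF h branch_mem[OF that, of n]] by simp
  fix x y :: real assume x: "x \<in> {0..1}" and y: "y \<in> {0..1}"
  let ?d = "logdist x y" and ?v = "\<lambda>x. 1 - 2 * ln (branch n x)"
  have vy: "1 \<le> ?v y" "0 \<le> ?v x" using ln_branch_nonpos[OF y, of n] ln_branch_nonpos[OF x, of n] by auto
  have "?v x \<le> ?v y + 2 * ?d" using ln_branch_le[OF y x, of n] by (simp add: logdist_commute)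
  also have "\<dots> \<le> ?v y * (1 + 2 * ?d)"
    using mult_right_mono[OF vy(1), of "2 * ?d"] logdist_nonneg[of x y] by (simp add: distrib_left)
  also have "\<dots> \<le> ?v y * exp (2 * ?d)"
    using vy by (intro mult_left_mono exp_ge_add_one_self) auto
  finally have v: "?v x \<le> exp (2 * ?d) * ?v y" by (simp add: mult.commute)
  have "(branch n x powr (2 * s) * h (branch n x)) * ?v x
    \<le> (exp ((2 * s + K / 2) * ?d) * (branch n y powr (2 * s) * h (branch n y))) * (exp (2 * ?d) * ?v y)"
    by (rule mult_mono[OF branch_weight_cone[OF h K s x y] v _ vy(2)])
       (simp add: logcone_nonneg[OF h branch_mem[OF y, of n]])
  also have "\<dots> = exp ((2 * s + K / 2 + 2) * ?d) * (branch n y powr (2 * s) * (?v y * h (branch n y)))"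
    by (simp add: exp_add algebra_simps)
  finally show "branch n x powr (2 * s) * (?v x * h (branch n x))
    \<le> exp ((2 * s + K / 2 + 2) * ?d) * (branch n y powr (2 * s) * (?v y * h (branch n y)))"
    by (simp add: mult_ac)
qed

lemma eigenpair_funpow:
  assumes e: "eigenpair s l h" and s: "s > 1 / 2" and x: "x \<in> {0..1}"
  shows "(transfer s ^^ n) h x = l ^ n * h x"
  using x
proof (induction n arbitrary: x)
  case (Suc n)
  have "(transfer s ^^ Suc n) h x = transfer s (\<lambda>y. l ^ n * h y) x"
    using Suc by (auto intro!: transfer_cong)
  also have "\<dots> = l ^ n * (l * h x)"
    using transfer_scale[OF s eigenpair_bounded[OF e s] Suc.prems] e Suc.prems by (simp add: eigenpair_def)
  finally show ?case by simp
qed simp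

text \<open>The derivative \<open>k\<close> of the logarithm of the eigenvalue makes the linearised eigenvalue equation
  \<open>L' h + L (h u) = l h (u + k)\<close> solvable; an approximate solution \<open>u\<close> is enough below.\<close>

definition corrector :: "real \<Rightarrow> real \<Rightarrow> (real \<Rightarrow> real) \<Rightarrow> real \<Rightarrow> real \<Rightarrow> (real \<Rightarrow> real) \<Rightarrow> bool" where
  "corrector s l h k e u \<longleftrightarrow> bounded (u ` {0..1}) \<and> (\<forall>x\<in>{0..1}.
     \<bar>(\<Sum>n. branch n x powr (2 * s) * (h (branch n x) * (u (branch n x) + 2 * ln (branch n x))))
       - l * h x * (u x + k)\<bar> \<le> e * (l * h x))"

lemma corrector_exists:
  assumes e: "eigenpair s l h" and s: "s > 1 / 2"
  obtains k where "\<And>e. 0 < e \<Longrightarrow> \<exists>u. corrector s l h k e u"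
proof -
  have l: "0 < l" and h: "h \<in> logcone (6 * s)" and h0: "h 0 = 1"
    and eig: "\<And>x. x \<in> {0..1} \<Longrightarrow> transfer s h x = l * h x"
    using e by (auto simp: eigenpair_def)
  note bh = eigenpair_bounded[OF e s]
  define K where "K = 8 * s + 8"
  have K: "8 * s \<le> K" "3 / 4 * K = 6 * s + 6" "0 \<le> 3 / 4 * K" using s by (auto simp: K_def)
  define w where "w t = (1 - 2 * ln t) * h t" for t
  have sw: "summable (\<lambda>n. branch n x powr (2 * s) * w (branch n x))"
    and wsum: "(\<Sum>n. branch n x powr (2 * s) * (h (branch n x) * (2 * ln (branch n x)))) = l * h x - transfer s w x"
    and sln: "summable (\<lambda>n. branch n x powr (2 * s) * (h (branch n x) * (2 * ln (branch n x))))"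
    if x: "x \<in> {0..1}" for x
  proof -
    note s1 = summable_transfer[OF s bh x] and s2 = summable_mult[OF summable_transfer_ln[OF s bh x], of 2]
    have sw_eq: "branch n x powr (2 * s) * w (branch n x) =
        branch n x powr (2 * s) * h (branch n x)
          - 2 * (branch n x powr (2 * s) * (h (branch n x) * ln (branch n x)))" for n
      by (simp add: w_def algebra_simps)
    show sw: "summable (\<lambda>n. branch n x powr (2 * s) * w (branch n x))"
      unfolding sw_eq by (rule summable_diff[OF s1 s2])
    show "summable (\<lambda>n. branch n x powr (2 * s) * (h (branch n x) * (2 * ln (branch n x))))"
      using s2 by (simp add: mult_ac)
    have "l * h x - transfer s w x = (\<Sum>n. branch n x powr (2 * s) * h (branch n x)
        - branch n x powr (2 * s) * w (branch n x))"
      using suminf_diff[OF s1 sw] eig[OF x] by (simp add: transfer_def)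
    then show "(\<Sum>n. branch n x powr (2 * s) * (h (branch n x) * (2 * ln (branch n x)))) = l * h x - transfer s w x"
      by (simp add: w_def algebra_simps)
  qed
  have "transfer s w \<in> logcone (2 * s + 6 * s / 2 + 2)"
    unfolding transfer_def[abs_def] w_def
    by (rule suminf_cone[OF _ log_weighted_branch_cone[OF h]]) (use sw s in \<open>simp_all add: w_def\<close>)
  then have tw: "transfer s w \<in> logcone (3 / 4 * K)"
    by (rule logcone_mono) (use s K in simp)
  define f0 where "f0 x = 1 / l * transfer s w x" for x
  have f0: "f0 \<in> logcone (3 / 4 * K)"
    unfolding f0_def[abs_def] using tw l by (intro logcone_scale) auto
  have hK: "h \<in> logcone (3 / 4 * K)" using h K by (auto elim: logcone_mono)
  define r where "r = 1 - contraction_gap K"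
  have r: "0 \<le> r" "r < 1" using contraction_gap_bounds[of K] K by (auto simp: r_def)
  have "0 < h 0" using h0 by simp
  then obtain c D where D: "0 \<le> D" and conv: "\<And>n x. x \<in> {0..1} \<Longrightarrow>
      \<bar>(transfer s ^^ n) f0 x - c * (transfer s ^^ n) h x\<bar> \<le> r ^ n * D * (transfer s ^^ n) h x"
    using transfer_iterates_converge[OF s K(1) f0 hK] unfolding r_def by metis
  define G where "G n x = (transfer s ^^ n) f0 x / l ^ n" for n x
  have bG: "bounded (G n ` {0..1})" for n
    using bounded_scale[OF logcone_bounded[OF transfer_funpow_cone[OF s K(1) f0, of n] K(3)], of "1 / l ^ n"]
    by (simp add: G_def)
  have Gc: "\<bar>G n x - c * h x\<bar> \<le> r ^ n * D * h x" if x: "x \<in> {0..1}" for n x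
  proof -
    have "(G n x - c * h x) * l ^ n = (transfer s ^^ n) f0 x - c * (l ^ n * h x)"
      using l by (simp add: G_def field_simps)
    moreover have "\<bar>(G n x - c * h x) * l ^ n\<bar> = \<bar>G n x - c * h x\<bar> * l ^ n"
      using l by (simp add: abs_mult)
    ultimately have "\<bar>G n x - c * h x\<bar> * l ^ n \<le> r ^ n * D * h x * l ^ n"
      using conv[OF x, of n] eigenpair_funpow[OF e s x, of n] by (simp add: mult_ac)
    then show ?thesis using l by simp
  qed
  have GS: "transfer s (G n) x = l * G (Suc n) x" if x: "x \<in> {0..1}" for n x
  proof -
    have "G n = (\<lambda>y. (1 / l ^ n) * (transfer s ^^ n) f0 y)" by (simp add: G_def fun_eq_iff)
    then have "transfer s (G n) x = (1 / l ^ n) * transfer s ((transfer s ^^ n) f0) x"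
      using transfer_scale[OF s logcone_bounded[OF transfer_funpow_cone[OF s K(1) f0, of n] K(3)] x]
      by (simp only:)
    then show ?thesis using l by (simp add: G_def)
  qed
  show thesis
  proof (rule that[of "1 - c"])
    fix eps :: real assume eps: "0 < eps"
    have "(\<lambda>n. r ^ n * D) \<longlonglongrightarrow> 0"
      using tendsto_mult_left_zero[OF LIMSEQ_realpow_zero[OF r]] by simp
    from order_tendstoD(2)[OF this eps] obtain N where N: "r ^ N * D < eps"
      by (auto simp: eventually_sequentially)
    define U where "U y = (\<Sum>n<N. G n y)" for y
    define u where "u y = - U y / h y" for y
    have bU: "bounded (U ` {0..1})"
    proof -
      have "bounded ((\<lambda>y. \<Sum>n<M. G n y) ` {0..1})" for M
        by (induction M) (simp_all add: image_constant_conv bounded_plus_comp bG)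
      then show ?thesis by (simp add: U_def[abs_def])
    qed
    obtain CU where CU: "\<And>y. y \<in> {0..1} \<Longrightarrow> \<bar>U y\<bar> \<le> CU"
      using bU unfolding bounded_iff by (metis imageI real_norm_def)
    have "\<bar>u y\<bar> \<le> CU / exp (- (6 * s * ln 2))" if y: "y \<in> {0..1}" for y
    proof -
      have "0 \<le> CU" using CU[OF y] by linarith
      moreover have "\<bar>u y\<bar> = \<bar>U y\<bar> / h y"
        using eigenpair_pos[OF e y] by (simp add: u_def)
      ultimately show ?thesis
        using CU[OF y] eigenpair_bounds(2)[OF e s y] by (simp add: frac_le)
    qed
    then have bu: "bounded (u ` {0..1})"
      unfolding bounded_iff by (intro exI[of _ "CU / exp (- (6 * s * ln 2))"]) (auto simp del: atLeastAtMost_iff)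
    have hu: "h y * u y = - 1 * U y" if "y \<in> {0..1}" for y
      using eigenpair_pos[OF e that] by (simp add: u_def)
    have "\<bar>(\<Sum>n. branch n x powr (2 * s) * (h (branch n x) * (u (branch n x) + 2 * ln (branch n x))))
       - l * h x * (u x + (1 - c))\<bar> \<le> eps * (l * h x)" if x: "x \<in> {0..1}" for x
    proof -
      have bhu: "bounded ((\<lambda>y. h y * u y) ` {0..1})"
        by (rule bounded_subset[OF bounded_scale[OF bU, of "- 1"]]) (use hu in force)
      have "(\<Sum>n. branch n x powr (2 * s) * (h (branch n x) * (u (branch n x) + 2 * ln (branch n x))))
        = transfer s (\<lambda>y. h y * u y) x + (l * h x - transfer s w x)"
        using suminf_add[OF summable_transfer[OF s bhu x] sln[OF x]] wsum[OF x]
        by (simp add: distrib_left transfer_def)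
      also have "transfer s (\<lambda>y. h y * u y) x = transfer s (\<lambda>y. - 1 * U y) x"
        by (rule transfer_cong[OF x hu])
      also have "\<dots> = - transfer s U x"
        using transfer_scale[OF s bU x, of "- 1"] by simp
      also have "transfer s U x = (\<Sum>n<N. l * G (Suc n) x)"
        unfolding U_def using transfer_sum[OF s bG x] GS[OF x] by simp
      also have "\<dots> = l * (\<Sum>n<N. G (Suc n) x)" by (simp add: sum_distrib_left)
      also have "(\<Sum>n<N. G (Suc n) x) = U x + (G N x - G 0 x)"
        using sum_lessThan_telescope[of "\<lambda>n. G n x" N] by (simp add: U_def sum_subtractf)
      finally have "(\<Sum>n. branch n x powr (2 * s) * (h (branch n x) * (u (branch n x) + 2 * ln (branch n x))))
        = - (l * (U x + (G N x - G 0 x))) + (l * h x - transfer s w x)" .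
      moreover have "transfer s w x = l * G 0 x" using l by (simp add: G_def f0_def)
      moreover have "l * h x * (u x + (1 - c)) = l * (- U x) + l * h x * (1 - c)"
        using hu[OF x] by (simp add: distrib_left mult.assoc)
      ultimately have "(\<Sum>n. branch n x powr (2 * s) * (h (branch n x) * (u (branch n x) + 2 * ln (branch n x))))
        - l * h x * (u x + (1 - c)) = - (l * (G N x - c * h x))"
        by (simp add: algebra_simps)
      moreover have "\<bar>G N x - c * h x\<bar> \<le> eps * h x"
        using Gc[OF x, of N] mult_right_mono[OF less_imp_le[OF N] less_imp_le[OF eigenpair_pos[OF e x]]] by linarith
      ultimately show ?thesis
        using l by (simp add: abs_mult mult_left_mono mult.left_commute)
    qed
    then show "\<exists>u. corrector s l h (1 - c) eps u"
      using bu by (auto simp: corrector_def simp del: atLeastAtMost_iff)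
  qed
qed

lemma exp_le_quadratic: "exp t \<le> 1 + t + t\<^sup>2 * exp \<bar>t\<bar>" for t :: real
proof -
  have "1 - t \<le> exp (- t)" using exp_ge_add_one_self[of "- t"] by simp
  then have "(1 - t) * exp t \<le> exp (- t) * exp t" by (rule mult_right_mono) simp
  then have 1: "exp t \<le> 1 + t * exp t" by (simp add: algebra_simps flip: exp_add)
  show ?thesis
  proof (cases "0 \<le> t")
    case True
    then have "t * exp t \<le> t * (1 + t * exp t)" using 1 by (intro mult_left_mono)
    then show ?thesis using 1 True by (simp add: algebra_simps power2_eq_square)
  next
    case False
    then have "t * (exp t - 1) \<le> t * t"
      using exp_ge_add_one_self[of t] by (intro mult_left_mono_neg) linarith+
    moreover have "t\<^sup>2 * 1 \<le> t\<^sup>2 * exp \<bar>t\<bar>" by (intro mult_left_mono) auto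
    ultimately show ?thesis using 1 by (simp add: algebra_simps power2_eq_square)
  qed
qed

lemma square_le_exp:
  assumes "0 < (a :: real)"
  shows "t\<^sup>2 \<le> 2 / a\<^sup>2 * exp (a * \<bar>t\<bar>)"
proof -
  have "(a * \<bar>t\<bar>)\<^sup>2 / 2 \<le> exp (a * \<bar>t\<bar>)"
    using exp_lower_Taylor_quadratic[of "a * \<bar>t\<bar>"] mult_nonneg_nonneg[OF less_imp_le[OF assms] abs_ge_zero[of t]]
    by linarith
  then show ?thesis using assms by (simp add: power_mult_distrib field_simps)
qed

lemma bounded_mult:
  fixes f g :: "real \<Rightarrow> real"
  assumes "bounded (f ` {0..1})" "bounded (g ` {0..1})"
  shows "bounded ((\<lambda>y. f y * g y) ` {0..1})"
proof -
  obtain B C where B: "\<And>y. y \<in> {0..1} \<Longrightarrow> \<bar>f y\<bar> \<le> B" and C: "\<And>y. y \<in> {0..1} \<Longrightarrow> \<bar>g y\<bar> \<le> C"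
    using assms unfolding bounded_iff by (metis imageI real_norm_def)
  have "0 \<le> B" using B[of 0] by simp
  then have "\<bar>f y * g y\<bar> \<le> B * C" if "y \<in> {0..1}" for y
    unfolding abs_mult by (intro mult_mono B C that) auto
  then show ?thesis
    unfolding bounded_iff by (intro exI[of _ "B * C"]) (auto simp del: atLeastAtMost_iff)
qed

lemma bounded_exp_scale:
  assumes "bounded (u ` {0..1})"
  shows "bounded ((\<lambda>y. exp (d * u y) :: real) ` {0..1::real})"
proof -
  obtain B where B: "\<And>y. y \<in> {0..1} \<Longrightarrow> \<bar>u y\<bar> \<le> B"
    using assms unfolding bounded_iff by (metis imageI real_norm_def)
  have "\<bar>exp (d * u y)\<bar> \<le> exp (\<bar>d\<bar> * B)" if "y \<in> {0..1}" for y
  proof -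
    have "d * u y \<le> \<bar>d\<bar> * \<bar>u y\<bar>" using abs_ge_self[of "d * u y"] by (simp add: abs_mult)
    also have "\<dots> \<le> \<bar>d\<bar> * B" by (intro mult_left_mono B[OF that]) simp
    finally show ?thesis by simp
  qed
  then show ?thesis
    unfolding bounded_iff by (intro exI[of _ "exp (\<bar>d\<bar> * B)"]) (auto simp del: atLeastAtMost_iff)
qed

locale tilt =
  fixes s l :: real and h u :: "real \<Rightarrow> real"
  assumes e: "eigenpair s l h" and s: "s > 1 / 2" and bu: "bounded (u ` {0..1})"
begin

text \<open>In probabilistic terms: \<open>p x n / (l * h x)\<close> is a probability vector, \<open>X x\<close> a random variable,
  and the operator with exponent \<open>s + d\<close> applied to the tilted eigenfunction computes the
  exponential moment of \<open>d * X x\<close>.\<close>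

definition "p x n = branch n x powr (2 * s) * h (branch n x)"

definition "X x n = u (branch n x) + 2 * ln (branch n x)"

definition "m x = (\<Sum>n. p x n * X x n)"

definition "g d y = h y * exp (d * u y)"

lemma l_pos: "0 < l"
  using e by (simp add: eigenpair_def)

lemma lh_pos: "x \<in> {0..1} \<Longrightarrow> 0 < l * h x"
  using l_pos eigenpair_pos[OF e] by simp

lemma p_nonneg: "x \<in> {0..1} \<Longrightarrow> 0 \<le> p x n"
  using eigenpair_pos[OF e branch_mem] by (simp add: p_def less_imp_le)

lemma p_sums: "x \<in> {0..1} \<Longrightarrow> p x sums (l * h x)"
  using summable_sums[OF summable_transfer[OF s eigenpair_bounded[OF e s], of x]] e
  by (simp add: p_def[abs_def] eigenpair_def transfer_def)

lemma pX_sums: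
  assumes x: "x \<in> {0..1}"
  shows "(\<lambda>n. p x n * X x n) sums m x"
proof -
  have "bounded ((\<lambda>y. h y * u y) ` {0..1})"
    by (rule bounded_mult[OF eigenpair_bounded[OF e s] bu])
  from summable_add[OF summable_transfer[OF s this x]
      summable_mult[OF summable_transfer_ln[OF s eigenpair_bounded[OF e s] x], of 2]]
  have "summable (\<lambda>n. p x n * X x n)"
    by (simp add: p_def X_def algebra_simps)
  then show ?thesis unfolding m_def by (rule summable_sums)
qed

lemma g_bounded: "bounded (g d ` {0..1})"
  unfolding g_def[abs_def] by (rule bounded_mult[OF eigenpair_bounded[OF e s] bounded_exp_scale[OF bu]])

lemma g_pos: "x \<in> {0..1} \<Longrightarrow> 0 < g d x"
  using eigenpair_pos[OF e] by (simp add: g_def)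

lemma tilted_term:
  assumes "x \<in> {0..1}"
  shows "branch n x powr (2 * (s + d)) * g d (branch n x) = p x n * exp (d * X x n)"
  using branch_pos[OF assms, of n]
  by (simp add: g_def p_def X_def powr_def exp_add[symmetric] algebra_simps)

lemma tilted_sums:
  assumes "x \<in> {0..1}" "s + d > 1 / 2"
  shows "(\<lambda>n. p x n * exp (d * X x n)) sums transfer (s + d) (g d) x"
  unfolding transfer_def tilted_term[OF assms(1), symmetric]
  by (rule summable_sums[OF summable_transfer[OF assms(2) g_bounded assms(1)]])

lemma transfer_tilted_ge:
  assumes x: "x \<in> {0..1}" and d: "s + d > 1 / 2"
  shows "l * h x * exp (d * (m x / (l * h x))) \<le> transfer (s + d) (g d) x"
proof -
  define M where "M = d * (m x / (l * h x))"
  have "exp M * (p x n + (d * (p x n * X x n) - M * p x n)) \<le> p x n * exp (d * X x n)" for n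
  proof -
    have "exp M * (1 + (d * X x n - M)) \<le> exp M * exp (d * X x n - M)"
      by (intro mult_left_mono exp_ge_add_one_self) simp
    then have "exp M * (1 + (d * X x n - M)) \<le> exp (d * X x n)"
      by (simp flip: exp_add)
    from mult_left_mono[OF this p_nonneg[OF x, of n]] show ?thesis
      by (simp add: algebra_simps)
  qed
  from sums_le[OF this sums_mult[OF sums_add[OF p_sums[OF x]
      sums_diff[OF sums_mult[OF pX_sums[OF x]] sums_mult[OF p_sums[OF x]]]]] tilted_sums[OF x d]]
  have "exp M * (l * h x + (d * m x - M * (l * h x))) \<le> transfer (s + d) (g d) x" .
  moreover have "M * (l * h x) = d * m x" using l_pos eigenpair_pos[OF e x] by (simp add: M_def)
  ultimately show ?thesis by (simp add: M_def mult_ac)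
qed

lemma transfer_tilted_le:
  obtains C r where "0 \<le> C" "0 < r" "\<And>d. \<bar>d\<bar> \<le> r \<Longrightarrow> s + d > 1 / 2"
    "\<And>d x. \<bar>d\<bar> \<le> r \<Longrightarrow> x \<in> {0..1} \<Longrightarrow>
      transfer (s + d) (g d) x \<le> l * h x * exp (d * (m x / (l * h x)) + C * d\<^sup>2)"
proof -
  define r where "r = (s - 1 / 2) / 4"
  have r: "0 < r" using s by (simp add: r_def)
  have sd: "s + d > 1 / 2" if "\<bar>d\<bar> \<le> r" for d
    using that s by (simp add: r_def abs_le_iff)
  obtain B where B: "\<And>y. y \<in> {0..1} \<Longrightarrow> \<bar>u y\<bar> \<le> B"
    using bu unfolding bounded_iff by (metis imageI real_norm_def)
  define E where "E = exp (6 * s * ln 2)"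
  define C0 where "C0 = 2 / r\<^sup>2 * exp (2 * r * B) * E"
  define s2 where "s2 = s - 2 * r"
  have s2: "s2 > 1 / 2" unfolding s2_def r_def using s by (simp add: field_simps)
  have E: "0 < E" by (simp add: E_def)
  have C0: "0 \<le> C0" using E by (simp add: C0_def)
  define C1 where "C1 = C0 * transfer s2 (\<lambda>_. 1) 0"
  have b1: "bounded ((\<lambda>_. 1 :: real) ` {0..1::real})" by (auto simp: bounded_iff)
  have "0 \<le> transfer s2 (\<lambda>_. 1) 0"
    unfolding transfer_def using summable_transfer[OF s2 b1, of 0] by (intro suminf_nonneg) auto
  then have C1: "0 \<le> C1" using C0 by (simp add: C1_def)
  have le: "transfer (s + d) (g d) x \<le> l * h x * exp (d * (m x / (l * h x)) + (C1 * E / l) * d\<^sup>2)"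
    if d: "\<bar>d\<bar> \<le> r" and x: "x \<in> {0..1}" for d x
  proof -
    have term_le: "p x n * exp (d * X x n) \<le> p x n + (d * (p x n * X x n)
        + d\<^sup>2 * C0 * (branch n x powr (2 * s2) * 1))" for n
    proof -
      let ?b = "branch n x"
      have b: "0 < ?b" using branch_pos[OF x] .
      have Xb: "\<bar>X x n\<bar> \<le> B - 2 * ln ?b"
        using B[OF branch_mem[OF x, of n]] ln_branch_nonpos[OF x, of n] by (simp add: X_def)
      have "(X x n)\<^sup>2 * exp \<bar>d * X x n\<bar> \<le> (2 / r\<^sup>2 * exp (r * \<bar>X x n\<bar>)) * exp (r * \<bar>X x n\<bar>)"
        using d by (intro mult_mono square_le_exp r) (auto simp: abs_mult mult_right_mono)
      also have "\<dots> = 2 / r\<^sup>2 * exp (2 * r * \<bar>X x n\<bar>)"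
        by (simp flip: exp_add)
      also have "\<dots> \<le> 2 / r\<^sup>2 * exp (2 * r * (B - 2 * ln ?b))"
        using Xb r by (intro mult_left_mono) auto
      also have "\<dots> = 2 / r\<^sup>2 * exp (2 * r * B) * ?b powr (- 4 * r)"
        using b by (simp add: powr_def algebra_simps flip: exp_add)
      finally have Q: "(X x n)\<^sup>2 * exp \<bar>d * X x n\<bar> \<le> 2 / r\<^sup>2 * exp (2 * r * B) * ?b powr (- 4 * r)" .
      have hb: "p x n \<le> ?b powr (2 * s) * E"
        unfolding p_def E_def by (intro mult_left_mono eigenpair_bounds(1)[OF e s branch_mem[OF x]]) simp
      have "p x n * ((X x n)\<^sup>2 * exp \<bar>d * X x n\<bar>)
          \<le> (?b powr (2 * s) * E) * (2 / r\<^sup>2 * exp (2 * r * B) * ?b powr (- 4 * r))"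
        using E by (intro mult_mono hb Q) auto
      also have "\<dots> = C0 * (?b powr (2 * s) * ?b powr (- 4 * r))" by (simp add: C0_def)
      also have "\<dots> = C0 * ?b powr (2 * s2)"
        unfolding powr_add[symmetric] by (simp add: s2_def algebra_simps)
      finally have Q2: "p x n * ((X x n)\<^sup>2 * exp \<bar>d * X x n\<bar>) \<le> C0 * ?b powr (2 * s2)" .
      have "p x n * exp (d * X x n) \<le> p x n * (1 + d * X x n + (d * X x n)\<^sup>2 * exp \<bar>d * X x n\<bar>)"
        by (intro mult_left_mono exp_le_quadratic p_nonneg[OF x])
      also have "\<dots> = p x n + d * (p x n * X x n) + d\<^sup>2 * (p x n * ((X x n)\<^sup>2 * exp \<bar>d * X x n\<bar>))"
        by (simp add: algebra_simps power_mult_distrib)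
      also have "\<dots> \<le> p x n + d * (p x n * X x n) + d\<^sup>2 * (C0 * ?b powr (2 * s2))"
        by (intro add_left_mono mult_left_mono Q2) simp
      finally show ?thesis by (simp add: mult_ac)
    qed
    have S: "(\<lambda>n. branch n x powr (2 * s2) * 1) sums transfer s2 (\<lambda>_. 1) x"
      using summable_sums[OF summable_transfer[OF s2 b1 x]] by (simp add: transfer_def)
    from sums_le[OF term_le tilted_sums[OF x sd[OF d]]
        sums_add[OF p_sums[OF x] sums_add[OF sums_mult[OF pX_sums[OF x]] sums_mult[OF S]]]]
    have "transfer (s + d) (g d) x \<le> l * h x + (d * m x + d\<^sup>2 * C0 * transfer s2 (\<lambda>_. 1) x)" .
    also have "\<dots> \<le> l * h x + (d * m x + d\<^sup>2 * C0 * transfer s2 (\<lambda>_. 1) 0)"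
      using C0 by (intro add_left_mono mult_left_mono transfer_one_le[OF s2 x]) auto
    also have "\<dots> = l * h x + (d * m x + d\<^sup>2 * C1)" by (simp add: C1_def)
    also have "d\<^sup>2 * C1 \<le> d\<^sup>2 * C1 * (E * h x)"
    proof -
      have "1 \<le> E * h x"
        using eigenpair_bounds(2)[OF e s x] E by (simp add: E_def exp_minus field_simps)
      then show ?thesis using mult_left_mono[of 1 "E * h x" "d\<^sup>2 * C1"] C1 by simp
    qed
    also have "l * h x + (d * m x + d\<^sup>2 * C1 * (E * h x))
        = l * h x * (1 + (d * (m x / (l * h x)) + (C1 * E / l) * d\<^sup>2))"
      using eigenpair_pos[OF e x] l_pos by (simp add: field_simps)
    also have "\<dots> \<le> l * h x * exp (d * (m x / (l * h x)) + (C1 * E / l) * d\<^sup>2)"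
      using lh_pos[OF x] by (intro mult_left_mono exp_ge_add_one_self) simp
    finally show ?thesis by simp
  qed
  have "0 \<le> C1 * E / l" using C1 E l_pos by simp
  then show thesis using that r sd le by blast
qed

end

context tilt
begin

lemma moment_corrector:
  assumes "corrector s l h k c u" "x \<in> {0..1}"
  shows "\<bar>m x / (l * h x) - (u x + k)\<bar> \<le> c"
proof -
  have "\<bar>m x - l * h x * (u x + k)\<bar> \<le> c * (l * h x)"
    using assms by (simp add: corrector_def m_def p_def X_def mult.assoc)
  moreover have "m x / (l * h x) - (u x + k) = (m x - l * h x * (u x + k)) / (l * h x)"
    using l_pos eigenpair_pos[OF e assms(2)] by (simp add: field_simps)
  ultimately show ?thesis
    using lh_pos[OF assms(2)] by (simp add: abs_divide pos_divide_le_eq)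
qed

lemma moment_scaled:
  assumes "corrector s l h k c u" "x \<in> {0..1}"
  shows "\<bar>d * (m x / (l * h x)) - d * (u x + k)\<bar> \<le> \<bar>d\<bar> * c"
  using mult_left_mono[OF moment_corrector[OF assms] abs_ge_zero[of d]]
  by (simp add: right_diff_distrib flip: abs_mult)

lemma pressure_lower:
  assumes c: "corrector s l h k c u" and d: "s + d > 1 / 2"
  shows "pressure s + (d * k - \<bar>d\<bar> * c) \<le> pressure (s + d)"
proof -
  obtain l' h' where e': "eigenpair (s + d) l' h'" by (rule eigenpair_exists[OF d])
  have "l * exp (d * k - \<bar>d\<bar> * c) \<le> l'"
  proof (rule eigenvalue_ge[OF e' d g_bounded g_pos])
    fix x :: real assume x: "x \<in> {0..1}"
    have "l * exp (d * k - \<bar>d\<bar> * c) * g d x = l * h x * exp (d * (u x + k) - \<bar>d\<bar> * c)"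
      by (simp add: g_def algebra_simps exp_add exp_diff)
    also have "\<dots> \<le> l * h x * exp (d * (m x / (l * h x)))"
      using moment_scaled[OF c x, of d] lh_pos[OF x] by (intro mult_left_mono) (auto simp: abs_le_iff)
    also have "\<dots> \<le> transfer (s + d) (g d) x" by (rule transfer_tilted_ge[OF x d])
    finally show "l * exp (d * k - \<bar>d\<bar> * c) * g d x \<le> transfer (s + d) (g d) x" .
  qed (use l_pos in auto)
  then have "ln (l * exp (d * k - \<bar>d\<bar> * c)) \<le> ln l'" using l_pos by (intro ln_mono) auto
  then show ?thesis
    using l_pos by (simp add: pressure_eq_ln[OF e s] pressure_eq_ln[OF e' d] ln_mult)
qed

lemma pressure_upper:
  assumes c: "corrector s l h k c u"
  obtains C r where "0 \<le> C" "0 < r" "\<And>d. \<bar>d\<bar> \<le> r \<Longrightarrow> s + d > 1 / 2"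
    "\<And>d. \<bar>d\<bar> \<le> r \<Longrightarrow> pressure (s + d) \<le> pressure s + (d * k + \<bar>d\<bar> * c + C * d\<^sup>2)"
proof -
  obtain C r where C: "0 \<le> C" "0 < r" and sd: "\<And>d. \<bar>d\<bar> \<le> r \<Longrightarrow> s + d > 1 / 2" and
    le: "\<And>d x. \<bar>d\<bar> \<le> r \<Longrightarrow> x \<in> {0..1} \<Longrightarrow>
      transfer (s + d) (g d) x \<le> l * h x * exp (d * (m x / (l * h x)) + C * d\<^sup>2)"
    using transfer_tilted_le by blast
  obtain B where B: "\<And>y. y \<in> {0..1} \<Longrightarrow> \<bar>u y\<bar> \<le> B"
    using bu unfolding bounded_iff by (metis imageI real_norm_def)
  have "pressure (s + d) \<le> pressure s + (d * k + \<bar>d\<bar> * c + C * d\<^sup>2)" if d: "\<bar>d\<bar> \<le> r" for d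
  proof -
    obtain l' h' where e': "eigenpair (s + d) l' h'" by (rule eigenpair_exists[OF sd[OF d]])
    have "l' \<le> l * exp (d * k + \<bar>d\<bar> * c + C * d\<^sup>2)"
    proof (rule eigenvalue_le[OF e' sd[OF d] g_bounded])
      fix x :: real assume x: "x \<in> {0..1}"
      have "\<bar>d * u x\<bar> \<le> \<bar>d\<bar> * B" unfolding abs_mult by (intro mult_left_mono B[OF x]) simp
      then have "exp (- (6 * s * ln 2)) * exp (- (\<bar>d\<bar> * B)) \<le> h x * exp (d * u x)"
        using eigenpair_pos[OF e x] by (intro mult_mono eigenpair_bounds(2)[OF e s x]) (auto simp: abs_le_iff)
      then show "exp (- (6 * s * ln 2)) * exp (- (\<bar>d\<bar> * B)) \<le> g d x" by (simp add: g_def)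
      have "transfer (s + d) (g d) x \<le> l * h x * exp (d * (m x / (l * h x)) + C * d\<^sup>2)"
        by (rule le[OF d x])
      also have "\<dots> \<le> l * h x * exp (d * (u x + k) + \<bar>d\<bar> * c + C * d\<^sup>2)"
        using moment_scaled[OF c x, of d] lh_pos[OF x] by (intro mult_left_mono) (auto simp: abs_le_iff)
      also have "\<dots> = l * exp (d * k + \<bar>d\<bar> * c + C * d\<^sup>2) * g d x"
        by (simp add: g_def algebra_simps exp_add)
      finally show "transfer (s + d) (g d) x \<le> l * exp (d * k + \<bar>d\<bar> * c + C * d\<^sup>2) * g d x" .
    qed simp
    moreover have "0 < l'" using e' by (simp add: eigenpair_def)
    ultimately have "ln l' \<le> ln (l * exp (d * k + \<bar>d\<bar> * c + C * d\<^sup>2))" by (intro ln_mono)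
    then show ?thesis
      using l_pos by (simp add: pressure_eq_ln[OF e s] pressure_eq_ln[OF e' sd[OF d]] ln_mult)
  qed
  then show thesis using that C sd by blast
qed

end

lemma pressure_has_derivative:
  assumes s: "s > 1 / 2"
  obtains k where "(pressure has_real_derivative k) (at s)"
    "\<And>s'. s' > 1 / 2 \<Longrightarrow> pressure s + k * (s' - s) \<le> pressure s'"
proof -
  obtain l h where e: "eigenpair s l h" by (rule eigenpair_exists[OF s])
  obtain k where k: "\<And>c. 0 < c \<Longrightarrow> \<exists>u. corrector s l h k c u"
    using corrector_exists[OF e s] by blast
  have tilt: "tilt s l h u" if "corrector s l h k c u" for c u
    using that e s by (simp add: tilt_def corrector_def)
  have sub: "pressure s + d * k \<le> pressure (s + d)" if d: "s + d > 1 / 2" for d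
  proof (rule field_le_epsilon)
    fix c :: real assume c: "0 < c"
    then have "0 < c / (\<bar>d\<bar> + 1)" by simp
    then obtain u where u: "corrector s l h k (c / (\<bar>d\<bar> + 1)) u" using k by blast
    have "pressure s + (d * k - \<bar>d\<bar> * (c / (\<bar>d\<bar> + 1))) \<le> pressure (s + d)"
      by (rule tilt.pressure_lower[OF tilt[OF u] u d])
    moreover have "\<bar>d\<bar> * (c / (\<bar>d\<bar> + 1)) \<le> c" using c by (simp add: field_simps)
    ultimately show "pressure s + d * k \<le> pressure (s + d) + c" by linarith
  qed
  have "(pressure has_real_derivative k) (at s)"
    unfolding DERIV_def
  proof (rule LIM_I)
    fix c :: real assume c: "0 < c"
    then obtain u where u: "corrector s l h k (c / 2) u" using k[of "c / 2"] by auto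
    obtain C r where C: "0 \<le> C" "0 < r" and sd: "\<And>d. \<bar>d\<bar> \<le> r \<Longrightarrow> s + d > 1 / 2"
      and up: "\<And>d. \<bar>d\<bar> \<le> r \<Longrightarrow> pressure (s + d) \<le> pressure s + (d * k + \<bar>d\<bar> * (c / 2) + C * d\<^sup>2)"
      using tilt.pressure_upper[OF tilt[OF u] u] by blast
    define t where "t = min r (c / (2 * (C + 1)))"
    have t: "0 < t" using C c by (simp add: t_def)
    have "norm ((pressure (s + d) - pressure s) / d - k) < c" if d: "d \<noteq> 0" "norm (d - 0) < t" for d
    proof -
      have dr: "\<bar>d\<bar> \<le> r" and dC: "\<bar>d\<bar> * (2 * (C + 1)) < c" using d C by (auto simp: t_def pos_less_divide_eq)
      have "C * \<bar>d\<bar> < c / 2" using dC d C by (simp add: algebra_simps)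
      then have "C * \<bar>d\<bar> * \<bar>d\<bar> < c / 2 * \<bar>d\<bar>" using d by (intro mult_strict_right_mono) auto
      then have "C * d\<^sup>2 < \<bar>d\<bar> * (c / 2)" by (simp add: power2_eq_square mult_ac)
      then have "\<bar>pressure (s + d) - pressure s - d * k\<bar> < \<bar>d\<bar> * c"
        using up[OF dr] sub[OF sd[OF dr]] by simp
      moreover have "(pressure (s + d) - pressure s) / d - k = (pressure (s + d) - pressure s - d * k) / d"
        using d by (simp add: field_simps)
      ultimately show ?thesis using d by (simp add: abs_divide pos_divide_less_eq mult.commute)
    qed
    then show "\<exists>t>0. \<forall>d. d \<noteq> 0 \<and> norm (d - 0) < t \<longrightarrow> norm ((pressure (s + d) - pressure s) / d - k) < c"
      using t by blast
  qed
  moreover have "pressure s + k * (s' - s) \<le> pressure s'" if "s' > 1 / 2" for s'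
    using sub[of "s' - s"] that by (simp add: mult.commute)
  ultimately show thesis using that by blast
qed

section \<open>Strict convexity and boundary behaviour\<close>

text \<open>Cauchy-Schwarz for the test function \<open>sqrt (h0 * h1)\<close>. It is uniformly strict, because the
  ratio of the two weights tends to 0 along the infinitely many branches.\<close>

lemma pressure_midpoint_strict:
  assumes s0: "1 / 2 < s0" and s01: "s0 < s1"
  shows "pressure ((s0 + s1) / 2) < (pressure s0 + pressure s1) / 2"
proof -
  have s1: "1 / 2 < s1" using s0 s01 by simp
  define sm where "sm = (s0 + s1) / 2"
  have sm: "1 / 2 < sm" using s0 s1 by (simp add: sm_def)
  obtain l0 h0 where e0: "eigenpair s0 l0 h0" by (rule eigenpair_exists[OF s0])
  obtain l1 h1 where e1: "eigenpair s1 l1 h1" by (rule eigenpair_exists[OF s1])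
  obtain l h where e: "eigenpair sm l h" by (rule eigenpair_exists[OF sm])
  have l: "0 < l0" "0 < l1" "0 < l" using e0 e1 e by (auto simp: eigenpair_def)
  define E0 E1 where "E0 = exp (6 * s0 * ln 2)" and "E1 = exp (6 * s1 * ln 2)"
  have E: "0 < E0" "0 < E1" by (auto simp: E0_def E1_def)
  have b0: "h0 x \<le> E0" "1 / E0 \<le> h0 x" and b1: "h1 x \<le> E1" "1 / E1 \<le> h1 x"
    and p0: "0 < h0 x" and p1: "0 < h1 x" if "x \<in> {0..1}" for x
    using eigenpair_bounds[OF e0 s0 that] eigenpair_bounds[OF e1 s1 that]
      eigenpair_pos[OF e0 that] eigenpair_pos[OF e1 that]
    by (auto simp: E0_def E1_def exp_minus inverse_eq_divide)
  define g where "g x = sqrt (h0 x * h1 x)" for x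
  have gb: "g x \<le> sqrt (E0 * E1)" "sqrt (1 / E0 * (1 / E1)) \<le> g x" if x: "x \<in> {0..1}" for x
  proof -
    have "h0 x * h1 x \<le> E0 * E1"
      using b0(1)[OF x] b1(1)[OF x] p1[OF x] E by (intro mult_mono) auto
    moreover have "1 / E0 * (1 / E1) \<le> h0 x * h1 x"
      using b0(2)[OF x] b1(2)[OF x] p0[OF x] E by (intro mult_mono) auto
    ultimately show "g x \<le> sqrt (E0 * E1)" "sqrt (1 / E0 * (1 / E1)) \<le> g x"
      unfolding g_def by (simp_all only: real_sqrt_le_mono)
  qed
  have g0: "0 \<le> g x" if "x \<in> {0..1}" for x
    using p0[OF that] p1[OF that] by (simp add: g_def)
  have bg: "bounded (g ` {0..1})"
    unfolding bounded_iff using gb(1) g0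
    by (intro exI[of _ "sqrt (E0 * E1)"]) (auto simp del: atLeastAtMost_iff)
  define a where "a = 2 * (s1 - s0)"
  have a: "0 < a" using s01 by (simp add: a_def)
  define A where "A = (E1 * E0) * (l0 * E0 * E1 / l1)"
  have A: "0 < A" using E l by (simp add: A_def)
  have "(\<lambda>n. real (Suc n) powr - a) \<longlonglongrightarrow> 0"
    using a by (intro tendsto_neg_powr filterlim_compose[OF filterlim_real_sequentially filterlim_Suc]) simp
  from order_tendstoD(2)[OF this, of "1 / (4 * A)"] obtain N where N: "real (Suc N) powr - a < 1 / (4 * A)"
    using A by (auto simp: eventually_sequentially)
  define \<eta> where "\<eta> = (1 / (real N + 2)) powr (2 * s0) * (1 / E0) / (l0 * E0) / 8"
  have \<eta>: "0 < \<eta>" using E l by (simp add: \<eta>_def)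
  have main: "transfer sm g x \<le> sqrt (l0 * l1) * (1 - \<eta>) * g x" if x: "x \<in> {0..1}" for x
  proof -
    define p where "p n = branch n x powr (2 * s0) * h0 (branch n x) / (l0 * h0 x)" for n
    define r where "r n = branch n x powr (2 * s1) * h1 (branch n x) / (l1 * h1 x)" for n
    note bx = branch_mem[OF x] and bp = branch_pos[OF x]
    have L0: "0 < l0 * h0 x" and L1: "0 < l1 * h1 x" using l p0[OF x] p1[OF x] by auto
    have p: "0 < p n" and r: "0 < r n" for n
      unfolding p_def r_def using bp[of n] p0[OF bx[of n]] p1[OF bx[of n]] L0 L1 by simp_all
    have psum: "p sums 1"
      using sums_divide[OF summable_sums[OF summable_transfer[OF s0 eigenpair_bounded[OF e0 s0] x]], of "l0 * h0 x"]
        e0 x l p0[OF x] by (simp add: eigenpair_def transfer_def p_def[abs_def])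
    have rsum: "r sums 1"
      using sums_divide[OF summable_sums[OF summable_transfer[OF s1 eigenpair_bounded[OF e1 s1] x]], of "l1 * h1 x"]
        e1 x l p1[OF x] by (simp add: eigenpair_def transfer_def r_def[abs_def])
    have gT: "branch n x powr (2 * sm) * g (branch n x) = sqrt (l0 * l1) * g x * sqrt (p n * r n)" for n
    proof -
      have "(branch n x powr (2 * sm))\<^sup>2 = branch n x powr (2 * s0) * branch n x powr (2 * s1)"
        by (simp add: power2_eq_square powr_add[symmetric] sm_def algebra_simps)
      then have "branch n x powr (2 * sm) = sqrt (branch n x powr (2 * s0) * branch n x powr (2 * s1))"
        by (metis powr_ge_zero real_sqrt_unique)
      then have "branch n x powr (2 * sm) * g (branch n x)
        = sqrt ((branch n x powr (2 * s0) * h0 (branch n x)) * (branch n x powr (2 * s1) * h1 (branch n x)))"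
        by (simp add: g_def real_sqrt_mult[symmetric] mult_ac)
      also have "\<dots> = sqrt ((l0 * l1) * (h0 x * h1 x) * (p n * r n))"
        using l p0[OF x] p1[OF x] by (simp add: p_def r_def field_simps)
      finally show ?thesis by (simp add: g_def real_sqrt_mult)
    qed
    have amgm: "sqrt (p n * r n) = (p n + r n) / 2 - (sqrt (p n) - sqrt (r n))\<^sup>2 / 2" for n
      using p[of n] r[of n] by (simp add: power2_diff real_sqrt_mult field_simps)
    have rN: "r N \<le> p N / 4"
    proof -
      let ?T = "branch N x"
      have Ta: "?T powr a \<le> 1 / (4 * A)"
      proof -
        have "?T powr a \<le> (1 / real (Suc N)) powr a"
          using a bp[of N] branch_le[OF x, of N] by (intro powr_mono2) auto
        then show ?thesis using N by (simp add: powr_divide powr_minus_divide)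
      qed
      have q1: "h1 ?T \<le> E1 * E0 * h0 ?T"
      proof -
        have "1 \<le> E0 * h0 ?T" using b0(2)[OF bx[of N]] E by (simp add: field_simps)
        then have "E1 * 1 \<le> E1 * (E0 * h0 ?T)" using E by (intro mult_left_mono) auto
        then show ?thesis using b1(1)[OF bx[of N]] by simp
      qed
      have q2: "1 / (l1 * h1 x) \<le> (l0 * E0 * E1 / l1) / (l0 * h0 x)"
      proof -
        have "h0 x * 1 \<le> E0 * (E1 * h1 x)"
          using b0(1)[OF x] b1(2)[OF x] E p1[OF x] by (intro mult_mono) (auto simp: field_simps)
        then show ?thesis using l p0[OF x] p1[OF x] by (simp add: field_simps)
      qed
      have "r N = (?T powr a * ?T powr (2 * s0)) * h1 ?T * (1 / (l1 * h1 x))"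
        unfolding powr_add[symmetric] by (simp add: r_def a_def algebra_simps)
      also have "\<dots> \<le> (1 / (4 * A) * ?T powr (2 * s0)) * (E1 * E0 * h0 ?T) * ((l0 * E0 * E1 / l1) / (l0 * h0 x))"
        using Ta q1 q2 A E L1 p1[OF bx[of N]] p0[OF bx[of N]] by (intro mult_mono) auto
      also have "\<dots> = 1 / (4 * A) * A * p N" by (simp add: p_def A_def)
      also have "\<dots> = p N / 4" using A by simp
      finally show ?thesis .
    qed
    have pN: "8 * \<eta> \<le> p N"
    proof -
      have "8 * \<eta> = ((1 / (real N + 2)) powr (2 * s0) * (1 / E0)) / (l0 * E0)"
        by (simp add: \<eta>_def)
      also have "\<dots> \<le> p N"
        unfolding p_def using s0 bp[of N] branch_ge[OF x, of N] b0(2)[OF bx[of N]] b0(1)[OF x] L0 l E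
          p0[OF bx[of N]] p0[OF x]
        by (intro frac_le mult_mono powr_mono2) auto
      finally show ?thesis .
    qed
    have amgm_gap: "sqrt (p n * r n) \<le> (p n + r n) / 2 - (if n = N then \<eta> else 0)" for n
    proof (cases "n = N")
      case True
      have "sqrt (r N) \<le> sqrt (p N / 4)" using rN by simp
      then have "sqrt (r N) \<le> sqrt (p N) / 2" by (simp add: real_sqrt_divide)
      then have "(sqrt (p N) / 2)\<^sup>2 \<le> (sqrt (p N) - sqrt (r N))\<^sup>2"
        using p[of N] by (intro power_mono) auto
      then have "p N / 4 \<le> (sqrt (p N) - sqrt (r N))\<^sup>2"
        using p[of N] by (simp add: power_divide)
      then show ?thesis using True amgm[of N] pN by simp
    next
      case False
      have "sqrt (p n * r n) \<le> (p n + r n) / 2"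
        using amgm[of n] zero_le_power2[of "sqrt (p n) - sqrt (r n)"] by linarith
      then show ?thesis using False by simp
    qed
    have gap_sums: "(\<lambda>n. (p n + r n) / 2 - (if n = N then \<eta> else 0)) sums ((1 + 1) / 2 - \<eta>)"
      by (intro sums_diff sums_divide sums_add psum rsum sums_single)
    have c: "0 \<le> sqrt (l0 * l1) * g x"
      using l g0[OF x] by simp
    have "(\<lambda>n. sqrt (l0 * l1) * g x * sqrt (p n * r n)) sums transfer sm g x"
      using summable_sums[OF summable_transfer[OF sm bg x]] by (simp add: gT transfer_def)
    from sums_le[OF mult_left_mono[OF amgm_gap c] this sums_mult[OF gap_sums]]
    have "transfer sm g x \<le> sqrt (l0 * l1) * g x * ((1 + 1) / 2 - \<eta>)" .
    then show ?thesis by (simp add: mult_ac)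
  qed
  have le: "l \<le> sqrt (l0 * l1) * (1 - \<eta>)"
    by (rule eigenvalue_le[OF e sm bg gb(2) _ main])
       (use E in \<open>auto intro!: real_sqrt_gt_zero mult_pos_pos\<close>)
  also have "\<dots> < sqrt (l0 * l1) * 1"
    using \<eta> l by (intro mult_strict_left_mono) auto
  finally have "ln l < ln (sqrt (l0 * l1))" using l by simp
  also have "\<dots> = (ln l0 + ln l1) / 2" using l by (simp add: ln_sqrt ln_mult)
  finally show ?thesis
    by (simp add: pressure_eq_ln[OF e0 s0] pressure_eq_ln[OF e1 s1] pressure_eq_ln[OF e sm] flip: sm_def)
qed

lemma pressure_ge_gamma0:
  assumes s: "1 / 2 < s"
  shows "- (s * gamma0) \<le> pressure s"
proof -
  obtain l h where e: "eigenpair s l h" by (rule eigenpair_exists[OF s])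
  define x :: real where "x = (sqrt 5 - 1) / 2"
  have s5: "1 < sqrt (5 :: real)" "sqrt (5 :: real) < 3"
    by (auto intro: real_less_rsqrt real_less_lsqrt)
  have x: "x \<in> {0..1}" "0 < x" using s5 by (auto simp: x_def)
  have "x * ((1 + sqrt 5) / 2) = 1" by (simp add: x_def algebra_simps)
  then have inv: "x = 1 / ((1 + sqrt 5) / 2)"
    using s5(1) nonzero_eq_divide_eq[of "(1 + sqrt 5) / 2" x 1] by force
  have "1 + x = (1 + sqrt 5) / 2" by (simp add: x_def field_simps)
  then have "x = 1 / (1 + x)" using inv by (simp only:)
  then have "branch 0 x = x" by (simp add: branch_def)
  then have "x powr (2 * s) * h x \<le> l * h x"
    using transfer_ge_term[of s h "6 * s" x 0] e s x(1) by (simp add: eigenpair_def)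
  then have "x powr (2 * s) \<le> l" using eigenpair_pos[OF e x(1)] by simp
  then have "2 * s * ln x \<le> ln l" using x(2) ln_mono[of "x powr (2 * s)" l] by (simp add: ln_powr)
  moreover have "ln x = - ln ((1 + sqrt 5) / 2)"
    unfolding inv using s5 by (subst ln_div) auto
  ultimately show ?thesis
    by (simp add: pressure_eq_ln[OF e s] gamma0_def mult_ac)
qed

text \<open>The Gauss density \<open>1 / (1 + x)\<close> is the fixed point of the operator at exponent 1.\<close>

lemma pressure_one_le: "pressure 1 \<le> 0"
proof -
  have s: "1 / 2 < (1 :: real)" by simp
  obtain l h where e: "eigenpair 1 l h" by (rule eigenpair_exists[OF s])
  define g :: "real \<Rightarrow> real" where "g x = 1 / (1 + x)" for x
  have bg: "bounded (g ` {0..1})"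
    unfolding bounded_iff by (intro exI[of _ 1]) (auto simp: g_def field_simps)
  have "transfer 1 g x \<le> 1 * g x" if x: "x \<in> {0..1}" for x
  proof -
    have "(\<lambda>n. 1 / (real n + 1 + x)) \<longlonglongrightarrow> 0"
      by (intro tendsto_divide_0[OF tendsto_const] filterlim_at_top_imp_at_infinity
          filterlim_at_top_mono[OF filterlim_real_sequentially]) (use x in \<open>auto intro!: always_eventually\<close>)
    from telescope_sums'[OF this]
    have "(\<lambda>n. 1 / (real n + 1 + x) - 1 / (real (Suc n) + 1 + x)) sums (1 / (1 + x))" by simp
    moreover have "branch n x powr (2 * 1) * g (branch n x) = 1 / (real n + 1 + x) - 1 / (real (Suc n) + 1 + x)" for n
    proof -
      define A where "A = real n + 1 + x"
      have A: "0 < A" using x by (simp add: A_def)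
      have br: "branch n x = 1 / A" by (simp add: branch_def A_def add_ac)
      have "branch n x powr (2 * 1) * g (branch n x) = (1 / A)\<^sup>2 / (1 + 1 / A)"
        using A by (simp add: g_def br)
      also have "\<dots> = 1 / A - 1 / (A + 1)"
        using A by (simp add: divide_simps power2_eq_square)
      finally show ?thesis by (simp add: A_def add_ac)
    qed
    ultimately show ?thesis by (simp add: transfer_def sums_iff g_def)
  qed
  then have "l \<le> 1"
    by (intro eigenvalue_le[OF e s bg, of "1 / 2"]) (auto simp: g_def field_simps)
  moreover have "0 < l" using e by (simp add: eigenpair_def)
  ultimately show ?thesis by (simp add: pressure_eq_ln[OF e s])
qed

lemma pressure_unbounded:
  obtains a where "1 / 2 < a" "\<And>s. 1 / 2 < s \<Longrightarrow> s < a \<Longrightarrow> M \<le> pressure s"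
proof -
  have "\<not> summable (\<lambda>n. 1 / (real n + 2))"
    using not_summable_harmonic[where ?'a = real] summable_iff_shift[of "\<lambda>n. 1 / real n" 2]
    by (simp add: inverse_eq_divide add.commute)
  then have "\<not> (\<forall>N. (\<Sum>n<N. 1 / (real n + 2)) \<le> exp M)"
    using summableI_nonneg_bounded[of "\<lambda>n. 1 / (real n + 2)" "exp M"] by auto
  then obtain N where N: "exp M < (\<Sum>n<N. 1 / (real n + 2))"
    by (auto simp: not_le)
  define S where "S s = (\<Sum>n<N. (1 / (real n + 2)) powr (2 * s))" for s
  have "(S \<longlongrightarrow> S (1 / 2)) (at_right (1 / 2))"
    unfolding S_def[abs_def] by (intro tendsto_intros) auto
  moreover have "exp M < S (1 / 2)" using N by (simp add: S_def)
  ultimately have "\<forall>\<^sub>F s in at_right (1 / 2). exp M < S s" by (rule order_tendstoD(1))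
  then obtain a where a: "1 / 2 < a" and S: "\<And>s. 1 / 2 < s \<Longrightarrow> s < a \<Longrightarrow> exp M < S s"
    by (auto simp: eventually_at_right_field)
  have "M \<le> pressure s" if s: "1 / 2 < s" "s < a" for s
  proof -
    obtain l h where e: "eigenpair s l h" by (rule eigenpair_exists[OF s(1)])
    have b1: "bounded ((\<lambda>_. 1 :: real) ` {0..1::real})" by (auto simp: bounded_iff)
    have "exp M \<le> l"
    proof (rule eigenvalue_ge[OF e s(1) b1])
      fix x :: real assume x: "x \<in> {0..1}"
      have "S s \<le> (\<Sum>n<N. branch n x powr (2 * s) * 1)"
        unfolding S_def using s branch_ge[OF x] by (intro sum_mono) (auto intro!: powr_mono2)
      also have "\<dots> \<le> transfer s (\<lambda>_. 1) x"
        unfolding transfer_def by (intro sum_le_suminf summable_transfer s b1 x) auto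
      finally show "exp M * 1 \<le> transfer s (\<lambda>_. 1) x" using S[OF s] by simp
    qed auto
    then have "ln (exp M) \<le> ln l" by (intro ln_mono) auto
    then show ?thesis by (simp add: pressure_eq_ln[OF e s(1)])
  qed
  with a show thesis using that by blast
qed

section \<open>The Legendre transform\<close>

lemma gamma0_pos: "0 < gamma0"
proof -
  have "1 < sqrt (5 :: real)" by (auto intro: real_less_rsqrt)
  then have "0 < ln ((1 + sqrt 5) / 2 :: real)" by (intro ln_gt_zero) simp
  then show ?thesis by (simp add: gamma0_def)
qed

lemma pressure_minimizer:
  assumes b: "gamma0 < b"
  obtains s where "1 / 2 < s" "(pressure has_real_derivative - b) (at s)"
    "\<And>s'. 1 / 2 < s' \<Longrightarrow> pressure s + s * b \<le> pressure s' + s' * b"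
proof -
  define G where "G s = pressure s + s * b" for s
  have b0: "0 < b" using b gamma0_pos by simp
  obtain a where a: "1 / 2 < a" "\<And>s. 1 / 2 < s \<Longrightarrow> s < a \<Longrightarrow> G 1 \<le> pressure s"
    using pressure_unbounded by blast
  define a' where "a' = (1 / 2 + min a 1) / 2"
  have a': "1 / 2 < a'" "a' < a" "a' < 1" using a(1) by (auto simp: a'_def field_simps)
  define c where "c = max 1 (G 1 / (b - gamma0))"
  have lo: "G 1 \<le> G s" if "1 / 2 < s" "s \<le> a'" for s
  proof -
    have "G 1 \<le> pressure s" using a(2)[of s] that a' by simp
    moreover have "0 \<le> s * b" using that b0 by simp
    ultimately show ?thesis unfolding G_def by linarith
  qed
  have hi: "G 1 \<le> G s" if "c \<le> s" for s
  proof -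
    have s: "1 \<le> s" "G 1 / (b - gamma0) \<le> s" using that by (auto simp: c_def)
    then have "G 1 \<le> s * (b - gamma0)" using b by (simp add: pos_divide_le_eq)
    also have "\<dots> \<le> G s" using pressure_ge_gamma0[of s] s by (simp add: G_def algebra_simps)
    finally show ?thesis .
  qed
  have der: "\<exists>k. (pressure has_real_derivative k) (at s)" if "1 / 2 < s" for s
    using pressure_has_derivative[OF that] by blast
  have "continuous_on {a'..c} pressure"
    using der a' by (intro continuous_at_imp_continuous_on ballI) (meson DERIV_isCont atLeastAtMost_iff less_le_trans)
  then have "continuous_on {a'..c} G"
    unfolding G_def[abs_def] by (intro continuous_intros)
  moreover have "1 \<in> {a'..c}" using a' by (simp add: c_def)
  ultimately obtain s where s: "s \<in> {a'..c}" and smin: "\<And>y. y \<in> {a'..c} \<Longrightarrow> G s \<le> G y"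
    using continuous_attains_inf[of "{a'..c}" G] by auto
  have s12: "1 / 2 < s" using s a' by simp
  have min: "G s \<le> G s'" if "1 / 2 < s'" for s'
    using smin[of s'] smin[OF \<open>1 \<in> {a'..c}\<close>] lo[OF that] hi[of s'] by force
  obtain k where k: "(pressure has_real_derivative k) (at s)" using der[OF s12] by blast
  have "(G has_real_derivative k + b) (at s)"
    unfolding G_def[abs_def] by (auto intro!: derivative_eq_intros k)
  then have "k + b = 0"
    by (rule DERIV_local_min[of _ _ _ "s - 1 / 2"]) (use s12 min in auto)
  then have "k = - b" by simp
  with k min s12 show thesis using that unfolding G_def by blast
qed

lemma pressure_critical_unique:
  assumes "1 / 2 < s" "1 / 2 < s'"
    and "(pressure has_real_derivative k) (at s)" "(pressure has_real_derivative k) (at s')"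
  shows "s = s'"
proof -
  have False if st: "1 / 2 < s" "s < t" "(pressure has_real_derivative k) (at s)" "(pressure has_real_derivative k) (at t)" for s t
  proof -
    have t: "1 / 2 < t" using st by simp
    have sub: "pressure v + k * (y - v) \<le> pressure y"
      if v: "1 / 2 < v" "(pressure has_real_derivative k) (at v)" and y: "1 / 2 < y" for v y
    proof -
      obtain k' where "(pressure has_real_derivative k') (at v)" "pressure v + k' * (y - v) \<le> pressure y"
        using pressure_has_derivative[OF v(1)] y by blast
      then show ?thesis using DERIV_unique[OF v(2)] by blast
    qed
    let ?m = "(s + t) / 2"
    have "pressure s + k * (?m - s) \<le> pressure ?m" "pressure t + k * (?m - t) \<le> pressure ?m"
      using sub[OF st(1,3), of ?m] sub[OF t st(4), of ?m] st t by auto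
    moreover have "k * (?m - s) + k * (?m - t) = 0" by (simp add: field_simps)
    ultimately show False using pressure_midpoint_strict[OF st(1,2)] by (simp add: field_simps)
  qed
  then show ?thesis using assms linorder_neqE_linordered_idom[of s s'] by blast
qed

theorem proposition6p4:
  fixes \<beta> :: real
  assumes "\<beta> > gamma0"
  shows "(\<exists>!q. is_hat_q \<beta> q)
    \<and> tilde_t \<beta> = pressure (- hat_q \<beta>) / \<beta> - hat_q \<beta>
    \<and> tilde_t \<beta> = 1 / \<beta> * (INF q\<in>{q. q < -1/2}. pressure (- q) - q * \<beta>)"
proof -
  have b: "0 < \<beta>" using assms gamma0_pos by simp
  obtain s where s: "1 / 2 < s" and der: "(pressure has_real_derivative - \<beta>) (at s)"
    and min: "\<And>s'. 1 / 2 < s' \<Longrightarrow> pressure s + s * \<beta> \<le> pressure s' + s' * \<beta>"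
    using pressure_minimizer[OF assms] by blast
  have crit: "1 / 2 < s' \<and> (pressure has_real_derivative - \<beta>) (at s') \<longleftrightarrow> s' = s" for s'
    using pressure_critical_unique[OF _ s _ der] s der by blast
  have shift: "((\<lambda>q'. P1 t q') has_real_derivative \<beta>) (at q)
      \<longleftrightarrow> (pressure has_real_derivative - \<beta>) (at (t - q))" for t q
    using DERIV_shift[of pressure "- \<beta>" "- q" t] DERIV_mirror[of "\<lambda>u. pressure (u + t)" "- \<beta>" q]
    by (simp add: P1_def)
  have hat: "is_hat_q \<beta> q \<longleftrightarrow> q = - s" for q
    using DERIV_mirror[of pressure "- \<beta>" q] crit[of "- q"] by (auto simp: is_hat_q_def)
  then have hat_q: "hat_q \<beta> = - s" by (simp add: hat_q_def)
  define q where "q = pressure s / \<beta>"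
  have qb: "pressure s = q * \<beta>" using b by (simp add: q_def)
  have "p \<in> D0 \<and> solves_system \<beta> p \<longleftrightarrow> p = (s + q, q)" for p
  proof -
    obtain t r where p: "p = (t, r)" by (cases p)
    have "p = (s + q, q)" if "p \<in> D0" "solves_system \<beta> p"
    proof -
      have tr: "t - r = s"
        using that crit[of "t - r"] by (simp add: p D0_def solves_system_def shift)
      moreover have "r = q"
        using that(2) b tr by (simp add: p solves_system_def P1_def q_def)
      ultimately show ?thesis by (simp add: p)
    qed
    moreover have "(s + q, q) \<in> D0 \<and> solves_system \<beta> (s + q, q)"
    proof -
      have "0 \<le> s * (\<beta> - gamma0)" using s assms by simp
      also have "\<dots> \<le> (s + q) * \<beta>"
        using pressure_ge_gamma0[OF s] qb by (simp add: algebra_simps)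
      finally have "0 \<le> s + q" using b by (simp add: zero_le_mult_iff)
      moreover have "(s + q) * \<beta> \<le> 1 * \<beta>"
        using min[of 1] pressure_one_le qb by (simp add: algebra_simps)
      then have "s + q \<le> 1" using b by simp
      moreover have "((\<lambda>q'. P1 (s + q) q') has_real_derivative \<beta>) (at q)"
        unfolding shift using der by simp
      moreover have "P1 (s + q) q = q * \<beta>" using qb by (simp add: P1_def)
      ultimately show ?thesis
        using s by (simp add: D0_def solves_system_def)
    qed
    ultimately show ?thesis by blast
  qed
  then have tilde: "tilde_t \<beta> = s + q" by (simp add: tilde_t_def)
  have inf: "(INF q\<in>{q. q < -1/2}. pressure (- q) - q * \<beta>) = pressure s + s * \<beta>"
  proof (rule cInf_eq_minimum)
    show "pressure s + s * \<beta> \<in> (\<lambda>q. pressure (- q) - q * \<beta>) ` {q. q < -1/2}"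
      using s by (intro image_eqI[of _ _ "- s"]) auto
    fix y assume "y \<in> (\<lambda>q. pressure (- q) - q * \<beta>) ` {q. q < -1/2}"
    then obtain q where "q < - 1 / 2" "y = pressure (- q) - q * \<beta>" by blast
    then show "pressure s + s * \<beta> \<le> y" using min[of "- q"] by simp
  qed
  have "\<exists>!q. is_hat_q \<beta> q" unfolding hat by simp
  moreover have "tilde_t \<beta> = pressure (- hat_q \<beta>) / \<beta> - hat_q \<beta>"
    by (simp add: tilde hat_q q_def)
  moreover have "tilde_t \<beta> = 1 / \<beta> * (pressure s + s * \<beta>)"
    using b by (simp add: tilde q_def field_simps)
  ultimately show ?thesis unfolding inf by blast
qed

end
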